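(* There exist two non-degenerate probability measures $\mu_1,\mu_2$ on the generating set $\{a,b,\bar b\}$ of the group $\Gamma=\mathbb Z_2*\mathbb Z_3$ such that the corresponding harmonic measures $\nu_1$ and $\nu_2$ on $\partial\Gamma$ are equivalent, whereas for every $0<t<1$ the harmonic measure $\nu$ of the convex combination $\mu=t\mu_1+(1-t)\mu_2$ is singular with respect to $\nu_1$ and $\nu_2$.
   Context: $\Gamma=\mathbb Z_2*\mathbb Z_3$ with $\mathbb Z_2=\langle a\mid a^2\rangle$, $\mathbb Z_3=\langle b\mid b^3\rangle$, $\bar b=b^{-1}=b^2$. Elements of $\Gamma$ are identified with finite words in $\{a,b,\bar b\}$ in which the letter $a$ and letters from $\{b,\bar b\}$ alternate. $\partial\Gamma$ is the set of right-infinite words in $\{a,b,\bar b\}$ subject to the same alternation rule, with the topology induced by the product topology; $\Gamma$ acts on it on the left by concatenation followed, if necessary, by reduction. A sequence $g_n\in\Gamma$ converges to $\gamma\in\partial\Gamma$ if for every $k$ the first $k$ letters of $g_n$ coincide with those of $\gamma$ for all large $n$. A probability measure $\mu$ on $\Gamma$ is non-degenerate if its support generates $\Gamma$ as a semigroup. For a non-degenerate $\mu$ as in the claim, the sample paths $g_n=h_1\cdots h_n$ (with $h_i$ independent and $\mu$-distributed) of the random walk $(\Gamma,\mu)$ converge almost surely to $\partial\Gamma$; the distribution of the limit is the harmonic measure of $\mu$; it is the unique probability measure $\nu$ on $\partial\Gamma$ with $\nu=\sum_g\mu(g)\,g\nu$. *)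

theory Defs
  imports "HOL-Probability.Probability" "HOL-Algebra.Group"
begin

section \<open>The group $\mathbb{Z}_2 * \mathbb{Z}_3$\<close>

text \<open>\<open>La\<close>, \<open>Lb\<close>, \<open>Lbar\<close> are the letters $a$, $b$ and $\bar b = b^{-1} = b^2$.\<close>

datatype letter = La | Lb | Lbar

instance letter :: countable
  by countable_datatype

instantiation letter :: discrete_topology
begin

definition open_letter :: "letter set \<Rightarrow> bool"
  where "open_letter U \<longleftrightarrow> True"

instance
  by standard (auto simp: open_letter_def)

end

instance letter :: second_countable_topology
proof
  have "open = generate_topology (range (\<lambda>x::letter. {x}))"
  proof (intro ext iffI)
    fix U :: "letter set"
    have "generate_topology (range (\<lambda>x::letter. {x})) (\<Union>x\<in>U. {x})"
      by (intro generate_topology_Union) (auto intro: generate_topology.Basis)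
    then show "generate_topology (range (\<lambda>x::letter. {x})) U" by simp
  qed (simp add: open_letter_def)
  then show "\<exists>B::letter set set. countable B \<and> open = generate_topology B"
    by (intro exI[of _ "range (\<lambda>x::letter. {x})"]) simp
qed

definition alternates :: "letter \<Rightarrow> letter \<Rightarrow> bool"
  where "alternates x y \<longleftrightarrow> (x = La) \<noteq> (y = La)"

definition words :: "letter list set"
  where "words = {w. successively alternates w}"

text \<open>Left multiplication of a reduced word by a letter: concatenation followed, if necessary,
  by a reduction $aa = b \bar b = \bar b b = 1$, $bb = \bar b$, $\bar b \bar b = b$.\<close>

fun lmult :: "letter \<Rightarrow> letter list \<Rightarrow> letter list"
  where
    "lmult La (La # w) = w"
  | "lmult Lb (Lb # w) = Lbar # w"
  | "lmult Lb (Lbar # w) = w"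
  | "lmult Lbar (Lbar # w) = Lb # w"
  | "lmult Lbar (Lb # w) = w"
  | "lmult x w = x # w"

definition Gamma_grp :: "letter list monoid"
  where "Gamma_grp = \<lparr>carrier = words, mult = foldr lmult, one = []\<rparr>"

fun inv_letter :: "letter \<Rightarrow> letter"
  where "inv_letter La = La" | "inv_letter Lb = Lbar" | "inv_letter Lbar = Lb"

lemma words_Nil [simp]: "[] \<in> words"
  and words_single [simp]: "[x] \<in> words"
  and words_Cons2: "x # y # w \<in> words \<longleftrightarrow> alternates x y \<and> y # w \<in> words"
  and words_ConsD: "x # w \<in> words \<Longrightarrow> w \<in> words"
  by (auto simp: words_def successively_Cons)

lemma lmult_in_words: "w \<in> words \<Longrightarrow> lmult x w \<in> words"
  by (induction x w rule: lmult.induct)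
     (auto simp: words_def successively_Cons alternates_def dest: words_ConsD)

lemma lmult_Cons: "x # w \<in> words \<Longrightarrow> lmult x w = x # w"
  by (induction x w rule: lmult.induct) (auto simp: words_Cons2 alternates_def)

lemma lmult_inv_letter: "w \<in> words \<Longrightarrow> lmult (inv_letter x) (lmult x w) = w"
  by (cases x; induction x w rule: lmult.induct)
     (auto simp: words_Cons2 alternates_def lmult_Cons)

lemma lmult_lmult:
  assumes "w \<in> words"
  shows "lmult La (lmult La w) = w" "lmult Lb (lmult Lb w) = lmult Lbar w"
    "lmult Lbar (lmult Lbar w) = lmult Lb w"
    "lmult Lb (lmult Lbar w) = w" "lmult Lbar (lmult Lb w) = w"
proof -
  have "lmult La (lmult La w) = w \<and> lmult Lb (lmult Lb w) = lmult Lbar w \<and>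
    lmult Lbar (lmult Lbar w) = lmult Lb w \<and> lmult Lb (lmult Lbar w) = w \<and>
    lmult Lbar (lmult Lb w) = w"
  proof (cases w)
    case (Cons y v)
    show ?thesis
    proof (cases v)
      case Nil
      with Cons show ?thesis by (cases y) auto
    next
      case (Cons z u)
      with \<open>w = y # v\<close> assms show ?thesis
        by (cases y; cases z) (auto simp: words_Cons2 alternates_def)
    qed
  qed auto
  then show "lmult La (lmult La w) = w" "lmult Lb (lmult Lb w) = lmult Lbar w"
    "lmult Lbar (lmult Lbar w) = lmult Lb w"
    "lmult Lb (lmult Lbar w) = w" "lmult Lbar (lmult Lb w) = w"
    by auto
qed

lemma foldr_lmult_in_words: "w \<in> words \<Longrightarrow> foldr lmult u w \<in> words"
  by (induction u) (auto intro: lmult_in_words)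

lemma foldr_lmult_lmult:
  assumes "w \<in> words"
  shows "foldr lmult (lmult x u) w = lmult x (foldr lmult u w)"
  by (induction x u rule: lmult.induct)
     (auto simp: lmult_lmult foldr_lmult_in_words[OF assms])

lemma foldr_lmult_assoc:
  "w \<in> words \<Longrightarrow> foldr lmult (foldr lmult u v) w = foldr lmult u (foldr lmult v w)"
  by (induction u) (auto simp: foldr_lmult_lmult)

lemma foldr_lmult_Nil: "u \<in> words \<Longrightarrow> foldr lmult u [] = u"
  by (induction u) (simp_all add: lmult_Cons words_ConsD)

lemma foldr_lmult_inverse:
  "foldr lmult (rev (map inv_letter u)) (foldr lmult u []) = []"
proof (induction u)
  case (Cons x u)
  have "foldr lmult u [] \<in> words"
    by (simp add: foldr_lmult_in_words)
  with Cons show ?case by (simp add: lmult_inv_letter)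
qed simp

theorem group_Gamma: "group Gamma_grp"
proof (rule groupI)
  fix u assume "u \<in> carrier Gamma_grp"
  then have u: "u \<in> words" by (simp add: Gamma_grp_def)
  let ?v = "foldr lmult (rev (map inv_letter u)) []"
  have "?v \<in> words" by (simp add: foldr_lmult_in_words)
  moreover have "foldr lmult ?v u = []"
    using foldr_lmult_assoc[OF u, of "rev (map inv_letter u)" "[]"]
      foldr_lmult_inverse[of u] u by (simp add: foldr_lmult_Nil)
  ultimately show "\<exists>v\<in>carrier Gamma_grp. v \<otimes>\<^bsub>Gamma_grp\<^esub> u = \<one>\<^bsub>Gamma_grp\<^esub>"
    by (auto simp: Gamma_grp_def)
qed (auto simp: Gamma_grp_def foldr_lmult_in_words foldr_lmult_assoc)

section \<open>The boundary\<close>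

definition boundary :: "(nat \<Rightarrow> letter) set"
  where "boundary = {\<gamma>. \<forall>n. alternates (\<gamma> n) (\<gamma> (Suc n))}"

text \<open>\<open>borel\<close> refers to the product topology on functions with \<open>letter\<close> discrete.\<close>

definition boundary_borel :: "(nat \<Rightarrow> letter) measure"
  where "boundary_borel = restrict_space borel boundary"

definition converges_to :: "(nat \<Rightarrow> letter list) \<Rightarrow> (nat \<Rightarrow> letter) \<Rightarrow> bool"
  where "converges_to g \<gamma> \<longleftrightarrow>
    \<gamma> \<in> boundary \<and> (\<forall>k. eventually (\<lambda>n. take k (g n) = map \<gamma> [0..<k]) sequentially)"

lemma converges_to_unique:
  assumes "converges_to g \<gamma>" "converges_to g \<gamma>'"
  shows "\<gamma> = \<gamma>'"
proof
  fix i
  have "eventually (\<lambda>n. map \<gamma> [0..<Suc i] = map \<gamma>' [0..<Suc i]) sequentially"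
    using assms[unfolded converges_to_def, THEN conjunct2, THEN spec, of "Suc i"]
    by eventually_elim simp
  then show "\<gamma> i = \<gamma>' i" by simp
qed

text \<open>Sequences without a limit in the boundary are sent to an arbitrary fixed boundary point, so
  that the function always takes values in \<open>boundary\<close>.\<close>

definition boundary_limit :: "(nat \<Rightarrow> letter list) \<Rightarrow> (nat \<Rightarrow> letter)"
  where "boundary_limit g =
    (if \<exists>\<gamma>. converges_to g \<gamma> then THE \<gamma>. converges_to g \<gamma> else SOME \<gamma>. \<gamma> \<in> boundary)"

lemma boundary_limit_eqI: "converges_to g \<gamma> \<Longrightarrow> boundary_limit g = \<gamma>"
  unfolding boundary_limit_def by (auto intro: converges_to_unique)

section \<open>Random walks and harmonic measures\<close>

inductive_set semigroup_generated :: "('a, 'b) monoid_scheme \<Rightarrow> 'a set \<Rightarrow> 'a set"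
  for G S where
    incl: "x \<in> S \<Longrightarrow> x \<in> semigroup_generated G S"
  | mult: "x \<in> semigroup_generated G S \<Longrightarrow> y \<in> semigroup_generated G S \<Longrightarrow>
      x \<otimes>\<^bsub>G\<^esub> y \<in> semigroup_generated G S"

definition nondegenerate :: "letter list pmf \<Rightarrow> bool"
  where "nondegenerate \<mu> \<longleftrightarrow> semigroup_generated Gamma_grp (set_pmf \<mu>) = carrier Gamma_grp"

text \<open>The sample path with increments $h_1, h_2, \dots$, where $h_{n+1}$ is \<open>h n\<close>.\<close>

primrec walk :: "(nat \<Rightarrow> letter list) \<Rightarrow> nat \<Rightarrow> letter list"
  where
    "walk h 0 = \<one>\<^bsub>Gamma_grp\<^esub>"
  | "walk h (Suc n) = walk h n \<otimes>\<^bsub>Gamma_grp\<^esub> h n"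

definition increments :: "letter list pmf \<Rightarrow> (nat \<Rightarrow> letter list) measure"
  where "increments \<mu> = (\<Pi>\<^sub>M n\<in>UNIV. measure_pmf \<mu>)"

definition harmonic_measure :: "letter list pmf \<Rightarrow> (nat \<Rightarrow> letter) measure"
  where "harmonic_measure \<mu> =
    distr (increments \<mu>) boundary_borel (\<lambda>h. boundary_limit (walk h))"

definition convex_comb_pmf :: "real \<Rightarrow> 'a pmf \<Rightarrow> 'a pmf \<Rightarrow> 'a pmf"
  where "convex_comb_pmf t p q = bernoulli_pmf t \<bind> (\<lambda>c. if c then p else q)"

lemma pmf_convex_comb_pmf:
  assumes "0 \<le> t" "t \<le> 1"
  shows "pmf (convex_comb_pmf t p q) x = t * pmf p x + (1 - t) * pmf q x"
  using assms by (simp add: convex_comb_pmf_def pmf_bind)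

section \<open>Equivalence and singularity\<close>

definition equivalent_measures :: "'a measure \<Rightarrow> 'a measure \<Rightarrow> bool"
  where "equivalent_measures M N \<longleftrightarrow>
    sets M = sets N \<and> absolutely_continuous M N \<and> absolutely_continuous N M"

definition singular_measures :: "'a measure \<Rightarrow> 'a measure \<Rightarrow> bool"
  where "singular_measures M N \<longleftrightarrow>
    sets M = sets N \<and> (\<exists>E\<in>sets M. emeasure M E = 0 \<and> emeasure N (space N - E) = 0)"

section \<open>Harmonic measures are probability measures\<close>

lemma boundary_nonempty: "(\<lambda>n. if even n then La else Lb) \<in> boundary"
  by (auto simp: boundary_def alternates_def)

lemma boundary_limit_in_boundary: "boundary_limit g \<in> boundary"
proof (cases "\<exists>\<gamma>. converges_to g \<gamma>")
  case True
  then show ?thesis by (auto simp: boundary_limit_eqI converges_to_def)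
next
  case False
  then show ?thesis
    unfolding boundary_limit_def using someI[of "\<lambda>\<gamma>. \<gamma> \<in> boundary", OF boundary_nonempty]
    by (simp only: if_False)
qed

lemma ex_converges_to_iff:
  "(\<exists>\<gamma>. converges_to g \<gamma>) \<longleftrightarrow>
    (\<forall>k. \<exists>w\<in>{w. length w = k \<and> w \<in> words}. eventually (\<lambda>n. take k (g n) = w) sequentially)"
proof
  assume "\<exists>\<gamma>. converges_to g \<gamma>"
  then obtain \<gamma> where "converges_to g \<gamma>" ..
  then show "\<forall>k. \<exists>w\<in>{w. length w = k \<and> w \<in> words}. eventually (\<lambda>n. take k (g n) = w) sequentially"
    by (intro allI bexI[where x = "map \<gamma> [0..<k]" for k])
       (auto simp: converges_to_def words_def boundary_def successively_conv_nth)
next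
  assume *: "\<forall>k. \<exists>w\<in>{w. length w = k \<and> w \<in> words}.
    eventually (\<lambda>n. take k (g n) = w) sequentially"
  then obtain W where W: "length (W k) = k" "W k \<in> words"
    "eventually (\<lambda>n. take k (g n) = W k) sequentially" for k
    by (simp add: Bex_def) metis
  define \<gamma> where "\<gamma> i = W (Suc i) ! i" for i
  have nth: "W k ! i = \<gamma> i" if "i < k" for i k
  proof -
    have "eventually (\<lambda>n. W k ! i = W (Suc i) ! i) sequentially"
      using W(3)[of k] W(3)[of "Suc i"]
    proof eventually_elim
      case (elim n)
      have "W k ! i = take k (g n) ! i" "W (Suc i) ! i = take (Suc i) (g n) ! i"
        using elim by simp_all
      then show ?case using that by simp
    qed
    then show ?thesis by (simp add: \<gamma>_def)
  qed
  have "W k = map \<gamma> [0..<k]" for k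
    by (rule nth_equalityI) (auto simp: W nth)
  moreover have "\<gamma> \<in> boundary"
    unfolding boundary_def
  proof safe
    fix n
    show "alternates (\<gamma> n) (\<gamma> (Suc n))"
      using W(1,2)[of "Suc (Suc n)"] nth[of n "Suc (Suc n)"] nth[of "Suc n" "Suc (Suc n)"]
      by (auto simp: words_def successively_conv_nth)
  qed
  ultimately show "\<exists>\<gamma>. converges_to g \<gamma>"
    using W(3) by (auto simp: converges_to_def)
qed

lemma walk_measurable:
  "(\<lambda>h. walk h n) \<in> increments \<mu> \<rightarrow>\<^sub>M count_space UNIV"
proof (induction n)
  case (Suc n)
  have h: "(\<lambda>h. h n) \<in> increments \<mu> \<rightarrow>\<^sub>M count_space UNIV"
    unfolding increments_def
    using measurable_component_singleton[of n UNIV "\<lambda>_. measure_pmf \<mu>"] by simp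
  show ?case
    unfolding walk.simps
    by (rule measurable_compose_countable[OF _ h])
       (rule measurable_compose[OF Suc], simp)
qed simp

lemma boundary_limit_walk_measurable:
  "(\<lambda>h. boundary_limit (walk h)) \<in> increments \<mu> \<rightarrow>\<^sub>M boundary_borel"
proof -
  note walk_measurable[measurable]
  have C [measurable]: "Measurable.pred (increments \<mu>) (\<lambda>h. \<exists>\<gamma>. converges_to (walk h) \<gamma>)"
    unfolding ex_converges_to_iff eventually_sequentially by measurable
  have eq: "boundary_limit (walk h) i = l \<longleftrightarrow>
    (if \<exists>\<gamma>. converges_to (walk h) \<gamma>
     then \<exists>w\<in>{w. length w = Suc i \<and> w ! i = l}.
       eventually (\<lambda>n. take (Suc i) (walk h n) = w) sequentially
     else (SOME \<gamma>. \<gamma> \<in> boundary) i = l)" for h i l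
  proof (cases "\<exists>\<gamma>. converges_to (walk h) \<gamma>")
    case True
    then obtain \<gamma> where \<gamma>: "converges_to (walk h) \<gamma>" ..
    define m where "m = map \<gamma> [0..<Suc i]"
    have m: "length m = Suc i" "m ! i = \<gamma> i"
      by (simp_all add: m_def del: upt_Suc)
    have ev: "eventually (\<lambda>n. take (Suc i) (walk h n) = m) sequentially"
      using \<gamma> unfolding converges_to_def m_def by blast
    have uniq: "w = m"
      if "eventually (\<lambda>n. take (Suc i) (walk h n) = w) sequentially" for w
    proof -
      have "eventually (\<lambda>n. w = m) sequentially"
        using that ev by eventually_elim simp
      then show ?thesis by simp
    qed
    have "(\<exists>w\<in>{w. length w = Suc i \<and> w ! i = l}.
        eventually (\<lambda>n. take (Suc i) (walk h n) = w) sequentially) \<longleftrightarrow> \<gamma> i = l"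
      (is "?L \<longleftrightarrow> _")
    proof
      assume ?L
      then obtain w where w: "w ! i = l"
        "eventually (\<lambda>n. take (Suc i) (walk h n) = w) sequentially"
        by (elim bexE CollectE conjE)
      show "\<gamma> i = l"
        using w(1) m(2) uniq[OF w(2)] by (simp only:)
    next
      assume "\<gamma> i = l"
      then show ?L using ev m by (intro bexI[of _ m] CollectI conjI) (simp_all only:)
    qed
    with True \<gamma> show ?thesis by (simp only: boundary_limit_eqI[OF \<gamma>] if_True)
  next
    case False
    then show ?thesis by (simp only: boundary_limit_def if_False)
  qed
  have "(\<lambda>h. boundary_limit (walk h) i) \<in> increments \<mu> \<rightarrow>\<^sub>M count_space UNIV" for i
  proof (subst measurable_count_space_eq2_countable, safe)
    fix l
    have "Measurable.pred (increments \<mu>) (\<lambda>h. \<exists>w\<in>{w. length w = Suc i \<and> w ! i = l}.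
        eventually (\<lambda>n. take (Suc i) (walk h n) = w) sequentially)"
      unfolding eventually_sequentially by measurable
    then have "Measurable.pred (increments \<mu>) (\<lambda>h. if \<exists>\<gamma>. converges_to (walk h) \<gamma>
        then \<exists>w\<in>{w. length w = Suc i \<and> w ! i = l}.
          eventually (\<lambda>n. take (Suc i) (walk h n) = w) sequentially
        else (SOME \<gamma>. \<gamma> \<in> boundary) i = l)"
      by (rule measurable_If[OF _ _ C[unfolded pred_def]]) (rule measurable_const, simp)
    then have "Measurable.pred (increments \<mu>) (\<lambda>h. boundary_limit (walk h) i = l)"
      by (rule measurable_cong[THEN iffD2, OF eq])
    then show "(\<lambda>h. boundary_limit (walk h) i) -` {l} \<inter> space (increments \<mu>)
        \<in> sets (increments \<mu>)"
      by (simp add: pred_def vimage_def Int_def conj_commute)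
  qed auto
  moreover have B: "sets (borel :: letter measure) = sets (count_space UNIV)"
    by (auto intro!: borel_open simp: open_letter_def)
  ultimately have "(\<lambda>h. boundary_limit (walk h) i) \<in> increments \<mu> \<rightarrow>\<^sub>M borel" for i
    by (simp only: measurable_cong_sets[OF refl B])
  then have "(\<lambda>h. boundary_limit (walk h)) \<in> increments \<mu> \<rightarrow>\<^sub>M borel"
    by (rule measurable_coordinatewise_then_product)
  then show ?thesis
    unfolding boundary_borel_def
    by (intro measurable_restrict_space2) (auto simp: boundary_limit_in_boundary)
qed

theorem prob_space_harmonic_measure: "prob_space (harmonic_measure \<mu>)"
proof -
  interpret prob_space "increments \<mu>"
    unfolding increments_def by (intro prob_space_PiM) (rule prob_space_measure_pmf)
  show ?thesis
    unfolding harmonic_measure_def by (rule prob_space_distr[OF boundary_limit_walk_measurable])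
qed

end

theory Submission
  imports Defs
begin

text \<open>The harmonic measure of a measure with weights \<open>\<alpha>, \<beta>, \<beta>' > 0\<close> on \<open>a, b, b\<^sup>-\<^sup>1\<close> is
  multiplicative Markov: the letters from \<open>{b, b\<^sup>-\<^sup>1}\<close> of the limit word are independent, each equal
  to \<open>b\<close> with the same probability \<open>r\<close>, and \<open>r\<close> is a root of an explicit polynomial whose
  coefficients are quadratic in \<open>(\<beta>, \<beta>')\<close>. Only the position of the first \<open>a\<close> involves another
  parameter, so two harmonic measures are equivalent if they have the same \<open>r\<close> and singular
  otherwise. For fixed \<open>r\<close> the polynomial equation describes a conic in the \<open>(\<beta>, \<beta>')\<close>-plane; two
  points of this conic have equivalent harmonic measures, whereas the open chord between them misses
  the conic.

  The cylinder weights are obtained from an explicit bounded harmonic function \<open>h\<close> with boundary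
  values the indicator of a cylinder: \<open>h (g\<^sub>n)\<close> has constant expectation and converges to the
  indicator of the event that the limit lies in the cylinder.\<close>

section \<open>Reduced words\<close>

lemma foldr_lmult_append: "u @ v \<in> words \<Longrightarrow> foldr lmult u v = u @ v"
proof (induction u)
  case (Cons x u)
  then have "u @ v \<in> words" using words_ConsD[of x "u @ v"] by simp
  with Cons show ?case by (simp add: lmult_Cons)
qed simp

lemma words_appendD: "u @ v \<in> words \<Longrightarrow> u \<in> words" "u @ v \<in> words \<Longrightarrow> v \<in> words"
  by (auto simp: words_def successively_append_iff)

lemma words_snoc2: "u @ [x, y] \<in> words \<longleftrightarrow> u @ [x] \<in> words \<and> alternates x y"
  by (auto simp: words_def successively_append_iff)

lemma words_snoc_change:
  "u @ [x] \<in> words \<Longrightarrow> (x = La) = (y = La) \<Longrightarrow> u @ [y] \<in> words"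
  by (auto simp: words_def successively_append_iff alternates_def)

text \<open>The walk multiplies on the right, whereas \<open>lmult\<close> reduces on the left; this
  is the right-hand rule. If the new letter neither cancels \<open>y\<close> nor alternates with it,
  then both lie in {b, b^{-1}} and are equal, and bb = b^{-1}, or its inverse relation, merges them
  into \<open>inv_letter y\<close>.\<close>

lemma foldr_lmult_snoc:
  assumes "u @ [y] \<in> words"
  shows "foldr lmult (u @ [y]) [x] =
    (if x = inv_letter y then u else if alternates y x then u @ [y, x] else u @ [inv_letter y])"
proof -
  have 1: "foldr lmult u [] = u"
    using words_appendD(1)[OF assms] by (rule foldr_lmult_Nil)
  have 2: "foldr lmult u [y, x] = u @ [y, x]" if "alternates y x"
    using foldr_lmult_append[of u "[y, x]"] assms that by (simp add: words_snoc2)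
  have 3: "foldr lmult u [inv_letter y] = u @ [inv_letter y]"
    by (rule foldr_lmult_append, rule words_snoc_change[OF assms]) (cases y; simp)
  show ?thesis
    using 1 2 3 by (cases x; cases y) (auto simp: alternates_def)
qed

section \<open>Inverse words and left translation of prefixes\<close>

definition inv_word :: "letter list \<Rightarrow> letter list"
  where "inv_word u = rev (map inv_letter u)"

lemma inv_letter_inv_letter [simp]: "inv_letter (inv_letter x) = x"
  by (cases x) auto

lemma inv_word_inv_word [simp]: "inv_word (inv_word u) = u"
  by (simp add: inv_word_def rev_map o_def)

lemma inv_letter_eq_La [simp]: "inv_letter x = La \<longleftrightarrow> x = La"
  by (cases x) auto

lemma inv_word_in_words: "u \<in> words \<Longrightarrow> inv_word u \<in> words"
  unfolding words_def inv_word_def mem_Collect_eq successively_rev successively_map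
  by (erule successively_mono) (auto simp: alternates_def)

lemma inv_word_lmult_cancel:
  "w \<in> words \<Longrightarrow> foldr lmult (inv_word u) (foldr lmult u w) = w"
proof (induction u)
  case (Cons x u)
  have "foldr lmult u w \<in> words" by (simp add: Cons.prems foldr_lmult_in_words)
  with Cons show ?case by (simp add: lmult_inv_letter inv_word_def)
qed (simp add: inv_word_def)

lemma lmult_inv_word_cancel:
  "w \<in> words \<Longrightarrow> foldr lmult u (foldr lmult (inv_word u) w) = w"
  using inv_word_lmult_cancel[of w "inv_word u"] by simp

lemma length_lmult_le: "length (lmult x w) \<le> Suc (length w)"
  by (induction x w rule: lmult.induct) auto

lemma length_foldr_lmult_le: "length (foldr lmult u w) \<le> length u + length w"
proof (induction u)
  case (Cons x u)
  then show ?case using length_lmult_le[of x "foldr lmult u w"] by simp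
qed simp

text \<open>Triangle inequality for word length, applied to g = v (v^{-1} g).\<close>

lemma length_inv_word_lmult_ge:
  "g \<in> words \<Longrightarrow> length g - length v \<le> length (foldr lmult (inv_word v) g)"
  using length_foldr_lmult_le[of v "foldr lmult (inv_word v) g"] lmult_inv_word_cancel[of g v]
  by simp

text \<open>If va is reduced, nothing cancels between \<open>v\<close> and a reduced word starting
  with a. Hence translation by v^{-1} reduces the question whether va is a prefix to a question
  about the first letter alone.\<close>

lemma prefix_iff_starts_with_La:
  assumes v: "v @ [La] \<in> words" and g: "g \<in> words"
  shows "take (Suc (length v)) g = v @ [La] \<longleftrightarrow>
    (\<exists>y. foldr lmult (inv_word v) g = La # y)"
proof
  assume "take (Suc (length v)) g = v @ [La]"
  then obtain y where gy: "g = v @ La # y"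
    by (metis append_take_drop_id append_Cons append_Nil append_assoc)
  have "foldr lmult v (La # y) = g" using g gy foldr_lmult_append[of v "La # y"] by simp
  moreover have "La # y \<in> words" using g gy words_appendD by blast
  ultimately show "\<exists>y. foldr lmult (inv_word v) g = La # y"
    using inv_word_lmult_cancel[of "La # y" v] by auto
next
  assume "\<exists>y. foldr lmult (inv_word v) g = La # y"
  then obtain y where y: "foldr lmult (inv_word v) g = La # y" ..
  then have "La # y \<in> words" using foldr_lmult_in_words[OF g, of "inv_word v"] by simp
  with v have "v @ La # y \<in> words"
    by (cases y) (auto simp: words_def successively_append_iff successively_Cons)
  then have "g = v @ La # y"
    using foldr_lmult_append lmult_inv_word_cancel[OF g, of v] y by simp
  then show "take (Suc (length v)) g = v @ [La]" by simp
qed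

text \<open>A letter on the right can only delete, replace or follow the last letter, so any proper
  prefix survives.\<close>

lemma take_rmult:
  assumes "g \<in> words" "k < length g"
  shows "take k (foldr lmult g [x]) = take k g"
proof -
  obtain u y where "g = u @ [y]" using assms(2) by (cases g rule: rev_cases) auto
  with assms show ?thesis
    using foldr_lmult_snoc[of u y x] by (auto simp del: foldr_append)
qed

section \<open>Random walks\<close>

lemma walk_in_words: "(\<And>n. h n \<in> words) \<Longrightarrow> walk h n \<in> words"
  by (induction n) (auto simp: Gamma_grp_def foldr_lmult_in_words)

text \<open>By associativity the product may be split after its first factor instead of before its
  last one, as first-step analysis requires.\<close>

lemma walk_Suc_left:
  assumes "\<And>n. h n \<in> words"
  shows "walk h (Suc n) = foldr lmult (h 0) (walk (\<lambda>i. h (Suc i)) n)"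
proof (induction n)
  case 0
  then show ?case using assms by (simp add: Gamma_grp_def foldr_lmult_Nil)
next
  case (Suc n)
  show ?case
    by (subst walk.simps(2), subst Suc.IH) (simp add: Gamma_grp_def foldr_lmult_assoc assms)
qed

text \<open>With single-letter increments a prefix cannot change any more once the length stays
  above its own, so every prefix stabilizes.\<close>

lemma converges_to_walk:
  assumes h: "\<And>n. h n \<in> {[La], [Lb], [Lbar]}"
    and len: "filterlim (\<lambda>n. length (walk h n)) at_top sequentially"
  shows "\<exists>\<gamma>. converges_to (walk h) \<gamma>"
  unfolding ex_converges_to_iff
proof
  fix k
  have W: "walk h n \<in> words" for n
    using h by (intro walk_in_words) (metis empty_iff insert_iff words_single)
  \<comment> \<open>One letter more than the prefix is required, because a step may alter the last
    letter.\<close>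
  from len have "eventually (\<lambda>n. Suc k \<le> length (walk h n)) sequentially"
    by (auto simp: filterlim_at_top)
  then obtain N where N: "\<And>n. n \<ge> N \<Longrightarrow> Suc k \<le> length (walk h n)"
    by (auto simp: eventually_sequentially)
  have eq: "take k (walk h n) = take k (walk h N)" if "n \<ge> N" for n
    using that
  proof (induction n rule: dec_induct)
    case (step n)
    obtain x where "h n = [x]" using h[of n] by auto
    then have "take k (walk h (Suc n)) = take k (walk h n)"
      using take_rmult[OF W[of n], of k x] N[OF step(1)] by (simp add: Gamma_grp_def)
    with step show ?case by simp
  qed simp
  show "\<exists>w\<in>{w. length w = k \<and> w \<in> words}. eventually (\<lambda>n. take k (walk h n) = w) sequentially"
  proof (intro bexI CollectI conjI)
    show "eventually (\<lambda>n. take k (walk h n) = take k (walk h N)) sequentially"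
      unfolding eventually_sequentially using eq by blast
    show "length (take k (walk h N)) = k" using N[of N] by simp
    show "take k (walk h N) \<in> words"
      using W[of N] words_appendD(1)[of "take k (walk h N)" "drop k (walk h N)"] by simp
  qed
qed

section \<open>Integration over the increments and the first-step decomposition\<close>

lemma AE_increments:
  assumes "set_pmf \<mu> \<subseteq> A"
  shows "AE h in increments \<mu>. \<forall>n. h n \<in> A"
  unfolding increments_def AE_all_countable
proof
  fix n :: nat
  have "AE x in measure_pmf \<mu>. x \<in> A"
    using assms by (auto simp: AE_measure_pmf_iff)
  then show "AE h in Pi\<^sub>M UNIV (\<lambda>_. measure_pmf \<mu>). h n \<in> A"
    by (intro AE_PiM_component prob_space_measure_pmf) auto
qed

text \<open>Markov property at time 1: by \<open>PiM_iter\<close> the infinite product is the law of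
  an independent first increment put in front of another copy of the sequence.\<close>

lemma nn_integral_walk_Suc:
  assumes "set_pmf \<mu> \<subseteq> words"
  shows "(\<integral>\<^sup>+h. u (foldr lmult x (walk h (Suc n))) \<partial>increments \<mu>) =
    (\<integral>\<^sup>+s. \<integral>\<^sup>+h. u (foldr lmult (foldr lmult x s) (walk h n)) \<partial>increments \<mu> \<partial>measure_pmf \<mu>)"
proof -
  interpret sequence_space "measure_pmf \<mu>"
    by unfold_locales
  have S: "S = increments \<mu>" by (simp add: increments_def)
  interpret I: prob_space "increments \<mu>"
    unfolding increments_def by (intro prob_space_PiM) (rule prob_space_measure_pmf)
  note walk_measurable[measurable]
  let ?u = "\<lambda>h. u (foldr lmult x (walk h (Suc n)))"
  have u: "?u \<in> borel_measurable (increments \<mu>)"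
    by (rule measurable_compose[OF walk_measurable]) simp
  have c: "(\<lambda>(s, \<omega>). case_nat s \<omega>) \<in> measurable (measure_pmf \<mu> \<Otimes>\<^sub>M increments \<mu>) (increments \<mu>)"
    unfolding S[symmetric] by measurable
  have "integral\<^sup>N (increments \<mu>) ?u =
      integral\<^sup>N (distr (measure_pmf \<mu> \<Otimes>\<^sub>M increments \<mu>) (increments \<mu>) (\<lambda>(s, \<omega>). case_nat s \<omega>)) ?u"
    using PiM_iter by (simp only: S)
  also have "\<dots> = (\<integral>\<^sup>+z. ?u (case z of (s, \<omega>) \<Rightarrow> case_nat s \<omega>) \<partial>(measure_pmf \<mu> \<Otimes>\<^sub>M increments \<mu>))"
    by (rule nn_integral_distr[OF c])
       (subst measurable_distr_eq1, rule u)
  also have "\<dots> = (\<integral>\<^sup>+s. \<integral>\<^sup>+\<omega>. ?u (case_nat s \<omega>) \<partial>increments \<mu> \<partial>measure_pmf \<mu>)"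
    by (subst I.nn_integral_fst[symmetric]) (use measurable_compose[OF c u] in \<open>simp_all del: walk.simps\<close>)
  also have "\<dots> = (\<integral>\<^sup>+s. \<integral>\<^sup>+h. u (foldr lmult (foldr lmult x s) (walk h n)) \<partial>increments \<mu> \<partial>measure_pmf \<mu>)"
  proof (rule nn_integral_cong_AE, unfold AE_measure_pmf_iff, intro ballI nn_integral_cong_AE)
    fix s assume s: "s \<in> set_pmf \<mu>"
    show "AE \<omega> in increments \<mu>. ?u (case_nat s \<omega>) = u (foldr lmult (foldr lmult x s) (walk \<omega> n))"
      using AE_increments[OF assms]
    proof eventually_elim
      case (elim \<omega>)
      have "walk (case_nat s \<omega>) (Suc n) = foldr lmult s (walk \<omega> n)"
        by (subst walk_Suc_left) (use elim s assms in \<open>auto split: nat.splits\<close>)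
      moreover have "walk \<omega> n \<in> words" using elim by (intro walk_in_words) auto
      ultimately show ?case by (simp only: foldr_lmult_assoc)
    qed
  qed
  finally show ?thesis .
qed

lemma prob_space_increments [simp]: "prob_space (increments \<mu>)"
  unfolding increments_def by (intro prob_space_PiM) (rule prob_space_measure_pmf)

text \<open>Increments are integrated out starting from the first one, which moves the starting
  point; therefore the induction runs over all \<open>x\<close> at once.\<close>

lemma nn_integral_walk_harmonic:
  assumes \<mu>: "set_pmf \<mu> \<subseteq> words"
    and u: "\<And>x. x \<in> words \<Longrightarrow> (\<integral>\<^sup>+s. u (foldr lmult x s) \<partial>measure_pmf \<mu>) = u x"
    and x: "x \<in> words"
  shows "(\<integral>\<^sup>+h. u (foldr lmult x (walk h n)) \<partial>increments \<mu>) = u x"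
  using x
proof (induction n arbitrary: x)
  case 0
  interpret prob_space "increments \<mu>" by simp
  show ?case using 0 by (simp add: Gamma_grp_def foldr_lmult_Nil emeasure_space_1)
next
  case (Suc n)
  have "(\<integral>\<^sup>+h. u (foldr lmult x (walk h (Suc n))) \<partial>increments \<mu>) = (\<integral>\<^sup>+s. u (foldr lmult x s) \<partial>measure_pmf \<mu>)"
    unfolding nn_integral_walk_Suc[OF \<mu>]
    by (rule nn_integral_cong_AE, unfold AE_measure_pmf_iff, intro ballI Suc.IH)
       (use \<mu> in \<open>auto intro: foldr_lmult_in_words\<close>)
  with u[OF Suc.prems] show ?case by simp
qed

text \<open>The same recursion with a contraction factor; for \<open>\<rho> < 1\<close> it yields
  the geometric decay behind transience.\<close>

lemma nn_integral_walk_supermartingale: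
  assumes \<mu>: "set_pmf \<mu> \<subseteq> words"
    and u: "\<And>x. x \<in> words \<Longrightarrow> (\<integral>\<^sup>+s. u (foldr lmult x s) \<partial>measure_pmf \<mu>) \<le> \<rho> * u x"
    and x: "x \<in> words"
  shows "(\<integral>\<^sup>+h. u (foldr lmult x (walk h n)) \<partial>increments \<mu>) \<le> \<rho> ^ n * u x"
  using x
proof (induction n arbitrary: x)
  case 0
  interpret prob_space "increments \<mu>" by simp
  show ?case using 0 by (simp add: Gamma_grp_def foldr_lmult_Nil emeasure_space_1)
next
  case (Suc n)
  have "(\<integral>\<^sup>+h. u (foldr lmult x (walk h (Suc n))) \<partial>increments \<mu>) \<le> (\<integral>\<^sup>+s. \<rho> ^ n * u (foldr lmult x s) \<partial>measure_pmf \<mu>)"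
    unfolding nn_integral_walk_Suc[OF \<mu>]
    by (rule nn_integral_mono_AE, unfold AE_measure_pmf_iff, intro ballI Suc.IH)
       (use \<mu> in \<open>auto intro: foldr_lmult_in_words\<close>)
  also have "\<dots> = \<rho> ^ n * (\<integral>\<^sup>+s. u (foldr lmult x s) \<partial>measure_pmf \<mu>)"
    by (rule nn_integral_cmult) simp
  also have "\<dots> \<le> \<rho> ^ n * (\<rho> * u x)"
    by (intro mult_left_mono u Suc.prems) simp
  finally show ?case by (simp add: mult_ac)
qed

section \<open>Transience\<close>

locale letter_walk =
  fixes \<mu> :: "letter list pmf"
  assumes set_pmf_subset: "set_pmf \<mu> \<subseteq> {[La], [Lb], [Lbar]}"
    and pmf_pos: "pmf \<mu> [La] > 0" "pmf \<mu> [Lb] > 0" "pmf \<mu> [Lbar] > 0"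
begin

abbreviation "\<alpha> \<equiv> pmf \<mu> [La]"
abbreviation "\<beta> \<equiv> pmf \<mu> [Lb]"
abbreviation "\<beta>' \<equiv> pmf \<mu> [Lbar]"

lemma pmf_sum: "\<alpha> + \<beta> + \<beta>' = 1"
  using sum_pmf_eq_1[OF _ set_pmf_subset] by simp

lemma set_pmf_words: "set_pmf \<mu> \<subseteq> words"
  using set_pmf_subset by auto

lemma nn_integral_letters:
  assumes "\<And>x. 0 \<le> f x"
  shows "(\<integral>\<^sup>+x. ennreal (f x) \<partial>measure_pmf \<mu>) = ennreal (\<alpha> * f [La] + \<beta> * f [Lb] + \<beta>' * f [Lbar])"
proof -
  have "(\<integral>\<^sup>+x. ennreal (f x) \<partial>measure_pmf \<mu>) = (\<Sum>x\<in>{[La], [Lb], [Lbar]}. ennreal (f x) * pmf \<mu> x)"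
    by (rule nn_integral_measure_pmf_support) (use set_pmf_subset in auto)
  also have "\<dots> = ennreal (\<alpha> * f [La] + \<beta> * f [Lb] + \<beta>' * f [Lbar])"
    using assms by (simp add: ennreal_mult'[symmetric] ennreal_plus[symmetric] mult_ac add_ac
        del: ennreal_plus)
  finally show ?thesis .
qed

text \<open>The inequalities make \<open>l\<close> to the number of letters \<open>a\<close>, times \<open>c\<close> unless the word ends in
  \<open>a\<close>, contract by the factor \<open>\<rho>\<close> under a step of the walk. To first order in \<open>1 - l\<close> they require
  \<open>c = 1 - d * (1 - l)\<close> with \<open>\<alpha> < d < \<alpha> / (1 - \<beta>)\<close> and \<open>d < \<alpha> / (1 - \<beta>')\<close>; here
  \<open>d = \<alpha> * (1 + min \<beta> \<beta>')\<close>.\<close>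

lemma lyapunov_parameters:
  obtains l c \<rho> :: real where "0 < l" "l < 1" "0 < c" "c \<le> 1" "0 \<le> \<rho>" "\<rho> < 1"
    "\<alpha> * c + (1 - \<alpha>) * (c * l) \<le> \<rho> * l"
    "\<alpha> * l + \<beta> * c + \<beta>' \<le> \<rho> * c"
    "\<alpha> * l + \<beta>' * c + \<beta> \<le> \<rho> * c"
proof -
  define \<delta> where "\<delta> = min \<beta> \<beta>'"
  \<comment> \<open>With e = 1 - l the first inequality has slack \<open>\<alpha>\<close> e
    (\<open>\<delta>\<close> - (1 + \<open>\<delta>\<close>)(1 - \<open>\<alpha>\<close>) e). The
    choice e = \<open>\<delta>\<close> / 2 keeps this positive, as (1 + \<open>\<delta>\<close>)(1 -
    \<open>\<alpha>\<close>) < 2.\<close>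
  define l where "l = 1 - \<delta> / 2"
  define c where "c = 1 - \<alpha> * (1 + \<delta>) * \<delta> / 2"
  have \<delta>: "0 < \<delta>" "\<delta> < 1" "\<delta> \<le> \<beta>" "\<delta> \<le> \<beta>'"
    using pmf_pos pmf_sum by (auto simp: \<delta>_def min_def)
  have \<alpha>: "0 < \<alpha>" "\<alpha> < 1" using pmf_pos pmf_sum by auto
  have l: "0 < l" "l < 1" using \<delta> by (auto simp: l_def)
  have "\<alpha> * (1 + \<delta>) * \<delta> < 1 * 2 * 1"
    using \<alpha> \<delta> by (intro mult_strict_mono) auto
  then have c: "0 < c" "c \<le> 1" using \<alpha> \<delta> by (auto simp: c_def)
  have "l - (\<alpha> * c + (1 - \<alpha>) * (c * l)) =
      \<alpha> * \<delta> / 2 * (\<delta> - (1 + \<delta>) * (1 - \<alpha>) * \<delta> / 2)"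
    by (simp add: l_def c_def field_simps power2_eq_square)
  moreover have "(1 + \<delta>) * (1 - \<alpha>) < 2 * 1"
    using \<alpha> \<delta> by (intro mult_strict_mono) auto
  then have "\<delta> * ((1 + \<delta>) * (1 - \<alpha>)) < \<delta> * 2"
    using \<delta> by (intro mult_strict_left_mono) auto
  then have "0 < \<alpha> * \<delta> / 2 * (\<delta> - (1 + \<delta>) * (1 - \<alpha>) * \<delta> / 2)"
    using \<alpha> \<delta> by (intro mult_pos_pos) (auto simp: algebra_simps)
  ultimately have 1: "\<alpha> * c + (1 - \<alpha>) * (c * l) < l" by linarith
  have aux: "\<alpha> * l + x * c + y < c" if "\<alpha> + x + y = 1" "\<delta> \<le> x" for x y
  proof -
    have "c - (\<alpha> * l + x * c + y) = \<alpha> * \<delta> / 2 * (1 - (1 + \<delta>) * (1 - x))"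
    proof -
      have y: "y = 1 - \<alpha> - x" using that by simp
      show ?thesis unfolding y by (simp add: l_def c_def field_simps power2_eq_square)
    qed
    moreover have "0 < 1 - (1 + \<delta>) * (1 - x)"
    proof -
      have "0 < \<delta> * x" using \<delta> that by auto
      then have "\<delta> < x + \<delta> * x" using that by linarith
      then show ?thesis by (simp add: algebra_simps)
    qed
    then have "0 < \<alpha> * \<delta> / 2 * (1 - (1 + \<delta>) * (1 - x))"
      using \<alpha> \<delta> by simp
    ultimately show ?thesis by linarith
  qed
  have 2: "\<alpha> * l + \<beta> * c + \<beta>' < c" "\<alpha> * l + \<beta>' * c + \<beta> < c"
    using aux[of \<beta> \<beta>'] aux[of \<beta>' \<beta>] pmf_sum \<delta> by (auto simp: add_ac)
  define \<rho> where "\<rho> = Max {0, (\<alpha> * c + (1 - \<alpha>) * (c * l)) / l, (\<alpha> * l + \<beta> * c + \<beta>') / c,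
    (\<alpha> * l + \<beta>' * c + \<beta>) / c}"
  have "\<rho> < 1" using 1 2 c l by (simp add: \<rho>_def)
  moreover have "0 \<le> \<rho>" by (simp add: \<rho>_def)
  moreover have "(\<alpha> * c + (1 - \<alpha>) * (c * l)) / l \<le> \<rho>" "(\<alpha> * l + \<beta> * c + \<beta>') / c \<le> \<rho>"
    "(\<alpha> * l + \<beta>' * c + \<beta>) / c \<le> \<rho>"
    by (simp_all add: \<rho>_def)
  then have "\<alpha> * c + (1 - \<alpha>) * (c * l) \<le> \<rho> * l" "\<alpha> * l + \<beta> * c + \<beta>' \<le> \<rho> * c"
    "\<alpha> * l + \<beta>' * c + \<beta> \<le> \<rho> * c"
    using c l by (simp_all only: pos_divide_le_eq)
  ultimately show ?thesis using that l c by blast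
qed

text \<open>The Lyapunov function \<open>f\<close> has expectation at most \<open>\<rho> ^ n\<close>
  along the walk. So the sum of its values has finite expectation and they tend to 0 almost surely;
  since \<open>f\<close> is at least \<open>c\<close> times \<open>l\<close> to the length, the
  length must diverge.\<close>

lemma AE_length_walk_at_top:
  "AE h in increments \<mu>. filterlim (\<lambda>n. length (walk h n)) at_top sequentially"
proof -
  obtain l c \<rho> :: real where lc: "0 < l" "l < 1" "0 < c" "c \<le> 1" and \<rho>: "0 \<le> \<rho>" "\<rho> < 1"
    and drift: "\<alpha> * c + (1 - \<alpha>) * (c * l) \<le> \<rho> * l"
    "\<alpha> * l + \<beta> * c + \<beta>' \<le> \<rho> * c" "\<alpha> * l + \<beta>' * c + \<beta> \<le> \<rho> * c"
    by (rule lyapunov_parameters)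
  define f where "f u = l ^ count_list u La * (if u \<noteq> [] \<and> last u = La then 1 else c)" for u
  have f_nonneg: "0 \<le> f u" for u using lc by (auto simp: f_def)
  have f_drift: "\<alpha> * f (foldr lmult x [La]) + \<beta> * f (foldr lmult x [Lb]) +
      \<beta>' * f (foldr lmult x [Lbar]) \<le> \<rho> * f x" if x: "x \<in> words" for x
  proof (cases x rule: rev_cases)
    case Nil
    \<comment> \<open>The empty word carries the factor \<open>c\<close>, and so do both its
      b-neighbours; the second drift inequality therefore holds with room to spare.\<close>
    have "\<beta>' * c \<le> \<beta>'" using lc pmf_pos by (intro mult_left_le) auto
    with drift(2) Nil show ?thesis by (simp add: f_def)
  next
    case (snoc u y)
    note L = foldr_lmult_snoc[OF x[unfolded snoc]]
    define k where "k = count_list u La"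
    have k: "0 \<le> l ^ k" using lc by simp
    have fu: "f u = l ^ k * c" if "y = La"
      using x that snoc by (cases u rule: rev_cases) (auto simp: f_def k_def words_snoc2 alternates_def)
    \<comment> \<open>Cancelling a final b or b^{-1} leaves a word ending in a, with value
      \<open>l ^ k\<close>, or the empty word, with value \<open>c\<close>; the bound covers
      both.\<close>
    have fu': "f u \<le> l ^ k"
      using lc by (auto simp: f_def k_def intro: mult_left_le)
    show ?thesis
    proof (cases y)
      case La
      have "l ^ k * (\<alpha> * c + (1 - \<alpha>) * (c * l)) \<le> l ^ k * (\<rho> * l)"
        using drift k by (intro mult_left_mono)
      moreover have "1 - \<alpha> = \<beta> + \<beta>'" using pmf_sum by simp
      ultimately show ?thesis
        unfolding snoc L using La fu
        by (simp add: alternates_def f_def[of "_ @ _"] k_def[symmetric] algebra_simps del: foldr_append)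
    next
      case Lb
      have "l ^ k * (\<alpha> * l + \<beta> * c + \<beta>') \<le> l ^ k * (\<rho> * c)"
        using drift k by (intro mult_left_mono)
      moreover have "\<beta>' * f u \<le> \<beta>' * l ^ k"
        using fu' by (intro mult_left_mono) auto
      ultimately show ?thesis
        unfolding snoc L using Lb
        by (simp add: alternates_def f_def[of "_ @ _"] k_def[symmetric] algebra_simps del: foldr_append)
    next
      case Lbar
      have "l ^ k * (\<alpha> * l + \<beta>' * c + \<beta>) \<le> l ^ k * (\<rho> * c)"
        using drift k by (intro mult_left_mono)
      moreover have "\<beta> * f u \<le> \<beta> * l ^ k"
        using fu' by (intro mult_left_mono) auto
      ultimately show ?thesis
        unfolding snoc L using Lbar
        by (simp add: alternates_def f_def[of "_ @ _"] k_def[symmetric] algebra_simps del: foldr_append)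
    qed
  qed
  have meas: "(\<lambda>h. ennreal (f (walk h n))) \<in> borel_measurable (increments \<mu>)" for n
    by (rule measurable_compose[OF walk_measurable]) simp
  have bound: "(\<integral>\<^sup>+h. ennreal (f (walk h n)) \<partial>increments \<mu>) \<le> ennreal (\<rho> ^ n)" for n
  proof -
    have "(\<integral>\<^sup>+h. ennreal (f (foldr lmult [] (walk h n))) \<partial>increments \<mu>) \<le> ennreal \<rho> ^ n * ennreal (f [])"
      by (rule nn_integral_walk_supermartingale[OF set_pmf_words])
         (use f_nonneg f_drift \<rho> in \<open>simp_all add: nn_integral_letters ennreal_mult'[symmetric] ennreal_leI
           del: ennreal_plus\<close>)
    also have "\<dots> = ennreal (\<rho> ^ n * f [])"
      using \<rho> by (simp add: ennreal_power ennreal_mult f_nonneg)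
    also have "\<dots> \<le> ennreal (\<rho> ^ n)"
      using \<rho> lc by (intro ennreal_leI mult_left_le) (auto simp: f_def)
    finally show ?thesis by simp
  qed
  have "(\<integral>\<^sup>+h. (\<Sum>n. ennreal (f (walk h n))) \<partial>increments \<mu>) = (\<Sum>n. \<integral>\<^sup>+h. ennreal (f (walk h n)) \<partial>increments \<mu>)"
    by (rule nn_integral_suminf[OF meas])
  also have "\<dots> \<le> (\<Sum>n. ennreal (\<rho> ^ n))"
    by (intro suminf_le bound) auto
  also have "\<dots> < \<infinity>"
    using \<rho> by (simp add: suminf_ennreal2 less_top)
  finally have "AE h in increments \<mu>. (\<Sum>n. ennreal (f (walk h n))) \<noteq> \<infinity>"
    using meas by (intro nn_integral_PInf_AE) auto
  then show ?thesis
  proof eventually_elim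
    case (elim h)
    then have "summable (\<lambda>n. f (walk h n))"
      using f_nonneg by (intro summable_suminf_not_top) auto
    then have lim: "(\<lambda>n. f (walk h n)) \<longlonglongrightarrow> 0" by (rule summable_LIMSEQ_zero)
    show ?case
      unfolding filterlim_at_top
    proof
      fix K
      have "0 < l ^ K * c" using lc by simp
      with lim have "eventually (\<lambda>n. f (walk h n) < l ^ K * c) sequentially"
        by (rule order_tendstoD)
      then show "eventually (\<lambda>n. K \<le> length (walk h n)) sequentially"
      proof eventually_elim
        case (elim n)
        have "l ^ length (walk h n) * c \<le> f (walk h n)"
          unfolding f_def using lc
          by (intro mult_mono power_decreasing count_le_length) auto
        with elim have "l ^ length (walk h n) < l ^ K"
          using lc by (meson le_less_trans mult_less_cancel_right_pos)
        then have "K < length (walk h n)"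
          using lc by (metis not_le power_decreasing less_imp_le)
        then show ?case by simp
      qed
    qed
  qed
qed

lemma AE_converges: "AE h in increments \<mu>. \<exists>\<gamma>. converges_to (walk h) \<gamma>"
  using AE_length_walk_at_top AE_increments[OF set_pmf_subset]
  by eventually_elim (rule converges_to_walk, auto)

end

section \<open>Cylinder sets\<close>

definition cylinder :: "letter list \<Rightarrow> (nat \<Rightarrow> letter) set"
  where "cylinder u = {\<gamma> \<in> boundary. map \<gamma> [0..<length u] = u}"

lemma cylinder_sets [measurable]: "cylinder u \<in> sets boundary_borel"
proof -
  have "open {\<gamma> :: nat \<Rightarrow> letter. \<gamma> i = l}" for i l
  proof -
    have "open ((\<lambda>\<gamma> :: nat \<Rightarrow> letter. \<gamma> i) -` {l})"
      by (rule open_vimage) (simp_all add: open_letter_def continuous_on_product_coordinates)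
    then show ?thesis by (simp add: vimage_def)
  qed
  then have "open (\<Inter>i<length u. {\<gamma> :: nat \<Rightarrow> letter. \<gamma> i = u ! i})"
    by (intro open_INT) auto
  moreover have "map \<gamma> [0..<length u] = u \<longleftrightarrow> (\<forall>i<length u. \<gamma> i = u ! i)" for \<gamma>
    by (subst list_eq_iff_nth_eq) simp
  then have "cylinder u = boundary \<inter> (\<Inter>i<length u. {\<gamma>. \<gamma> i = u ! i})"
    unfolding cylinder_def by blast
  ultimately show ?thesis
    unfolding boundary_borel_def by (auto simp: sets_restrict_space)
qed

text \<open>After b or b^{-1} the alternation rule forces an a. Thus it suffices to compute weights
  of cylinders over words ending in a.\<close>

lemma cylinder_snoc_La:
  assumes "u \<noteq> []" "last u \<noteq> La"
  shows "cylinder (u @ [La]) = cylinder u"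
proof -
  have "\<gamma> (length u) = La" if "\<gamma> \<in> boundary" "map \<gamma> [0..<length u] = u" for \<gamma>
  proof -
    have "last u = \<gamma> (length u - 1)"
      using assms(1) that(2) by (metis diff_less last_conv_nth length_greater_0_conv less_numeral_extra(1)
          nth_map_upt add_0 diff_zero)
    moreover have "alternates (\<gamma> (length u - 1)) (\<gamma> (Suc (length u - 1)))"
      using that(1) unfolding boundary_def by blast
    ultimately show ?thesis using assms by (simp add: alternates_def)
  qed
  then show ?thesis by (auto simp: cylinder_def)
qed

lemma emeasure_harmonic_measure:
  assumes "E \<in> sets boundary_borel"
  shows "emeasure (harmonic_measure \<mu>) E =
    (\<integral>\<^sup>+h. indicator E (boundary_limit (walk h)) \<partial>increments \<mu>)"
proof -
  have "emeasure (harmonic_measure \<mu>) E = (\<integral>\<^sup>+\<gamma>. indicator E \<gamma> \<partial>harmonic_measure \<mu>)"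
    using assms by (simp add: harmonic_measure_def)
  also have "\<dots> = (\<integral>\<^sup>+h. indicator E (boundary_limit (walk h)) \<partial>increments \<mu>)"
    unfolding harmonic_measure_def
    by (rule nn_integral_distr[OF boundary_limit_walk_measurable])
       (use assms in \<open>simp add: measurable_distr_eq1\<close>)
  finally show ?thesis .
qed

section \<open>Harmonic functions and the harmonic measure\<close>

text \<open>Transition weights of the multiplicative Markov measure: an a after a b-letter is
  forced, hence the weight 1.\<close>

definition ratio_weight :: "real \<Rightarrow> letter \<Rightarrow> real"
  where "ratio_weight r x = (case x of La \<Rightarrow> 1 | Lb \<Rightarrow> r | Lbar \<Rightarrow> 1 - r)"

lemma ratio_weight_simps [simp]:
  "ratio_weight r La = 1" "ratio_weight r Lb = r" "ratio_weight r Lbar = 1 - r"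
  by (simp_all add: ratio_weight_def)

text \<open>\<open>balance\<close> is the condition that the right-hand sides of the two equations
  in \<open>exit_equations\<close> are in the ratio r : (1 - r), once \<open>w\<close> is written in
  terms of \<open>r\<close>.\<close>

locale letter_walk_ratio = letter_walk +
  fixes r :: real
  assumes r: "0 < r" "r < 1"
    and balance: "\<beta>' * (3 * r - 1 - r\<^sup>2) - \<beta> * (1 - r - r\<^sup>2) =
      (\<beta>' * (1 - r) + \<beta> * r) * (r * \<beta>' - (1 - r) * \<beta>)"
begin

text \<open>Additivity over the continuations ba and b^{-1}a of a cylinder suggests
  \<open>F La * F Lb = r\<close> and \<open>F La * F Lbar = 1 - r\<close>. Inserting this into the
  first-step equation for visiting a, and eliminating \<open>\<alpha>\<close>, gives this
  expression.\<close>

definition w :: real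
  where "w = 1 - \<beta>' * (1 - r) - \<beta> * r"

text \<open>\<open>F x\<close> is the probability that the walk started at the identity ever visits \<open>[x]\<close>.\<close>

definition F :: "letter \<Rightarrow> real"
  where "F x = (case x of La \<Rightarrow> w | Lb \<Rightarrow> r / w | Lbar \<Rightarrow> (1 - r) / w)"

lemma F_simps [simp]: "F La = w" "F Lb = r / w" "F Lbar = (1 - r) / w"
  by (simp_all add: F_def)

section \<open>The first-step equations for the hitting probabilities\<close>

lemma w_eq: "w = \<alpha> + \<beta> * (1 - r) + \<beta>' * r"
proof -
  have "1 = \<alpha> + \<beta> + \<beta>'" using pmf_sum by simp
  then show ?thesis by (simp add: w_def algebra_simps)
qed

lemma w_pos: "0 < w"
  unfolding w_eq using pmf_pos r by (intro add_pos_pos mult_pos_pos) auto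

lemma w_less_1: "w < 1"
proof -
  have "0 < \<beta>' * (1 - r)" "0 < \<beta> * r" using pmf_pos r by auto
  then show ?thesis by (simp add: w_def)
qed

text \<open>The sum of the two equations follows from the definition of \<open>w\<close> and the
  total mass 1, and their ratio from \<open>balance\<close>; sum and ratio determine both.\<close>

lemma exit_equations:
  "r * (1 - \<alpha> * w) = \<beta>' * (1 - r) + \<beta> * w"
  "(1 - r) * (1 - \<alpha> * w) = \<beta> * r + \<beta>' * w"
proof -
  define X where "X = \<beta>' * (1 - r) + \<beta> * w"
  define Y where "Y = \<beta> * r + \<beta>' * w"
  have "X + Y = (1 - w) + (\<beta> + \<beta>') * w"
    by (simp add: X_def Y_def w_def algebra_simps)
  also have "\<beta> + \<beta>' = 1 - \<alpha>" using pmf_sum by simp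
  also have "1 - w + (1 - \<alpha>) * w = 1 - \<alpha> * w" by (simp add: algebra_simps)
  finally have sum: "1 - \<alpha> * w = X + Y" by simp
  have "(1 - r) * X - r * Y = \<beta>' * (1 - r)\<^sup>2 - \<beta> * r\<^sup>2 - w * (r * \<beta>' - (1 - r) * \<beta>)"
    by (simp add: X_def Y_def algebra_simps power2_eq_square)
  also have "\<dots> = (\<beta>' * (1 - r) + \<beta> * r) * (r * \<beta>' - (1 - r) * \<beta>) -
      (\<beta>' * (3 * r - 1 - r\<^sup>2) - \<beta> * (1 - r - r\<^sup>2))"
    by (simp add: w_def algebra_simps power2_eq_square)
  also have "\<dots> = 0" using balance by simp
  finally have cross: "(1 - r) * X = r * Y" by simp
  show "r * (1 - \<alpha> * w) = \<beta>' * (1 - r) + \<beta> * w" "(1 - r) * (1 - \<alpha> * w) = \<beta> * r + \<beta>' * w"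
    using cross unfolding sum X_def[symmetric] Y_def[symmetric] by (simp_all add: algebra_simps)
qed

text \<open>First-step equations: after a wrong step the remaining displacement is a product of two
  letters to be covered in turn, except that b is reached from b^{-1} by the single letter bb =
  b^{-1}, and symmetrically. The last two are the exit equations divided by
  \<open>w\<close>.\<close>

lemma F_eqs:
  "F La = \<alpha> + \<beta> * (F La * F Lbar) + \<beta>' * (F La * F Lb)"
  "F Lb = \<beta> + \<alpha> * (F Lb * F La) + \<beta>' * F Lbar"
  "F Lbar = \<beta>' + \<alpha> * (F Lbar * F La) + \<beta> * F Lb"
proof -
  have "r / w = \<beta> + \<alpha> * r + \<beta>' * ((1 - r) / w)" "(1 - r) / w = \<beta>' + \<alpha> * (1 - r) + \<beta> * (r / w)"
    using exit_equations w_pos by (simp_all add: field_simps)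
  moreover have mult: "w * ((1 - r) / w) = 1 - r" "w * (r / w) = r" "(1 - r) / w * w = 1 - r" "r / w * w = r"
    using w_pos by simp_all
  ultimately show "F La = \<alpha> + \<beta> * (F La * F Lbar) + \<beta>' * (F La * F Lb)"
    "F Lb = \<beta> + \<alpha> * (F Lb * F La) + \<beta>' * F Lbar"
    "F Lbar = \<beta>' + \<alpha> * (F Lbar * F La) + \<beta> * F Lb"
    using w_eq mult by (simp_all only: F_simps)
qed

lemma F_pos: "0 < F x"
  using w_pos r by (cases x) auto

text \<open>Maximum principle: if the larger value \<open>M\<close> of \<open>F Lb\<close> and
  \<open>F Lbar\<close> were at least 1, its first-step equation would bound it strictly by
  (\<open>\<alpha>\<close> + x + y) \<open>M\<close> = \<open>M\<close>, the strictness coming from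
  \<open>w < 1\<close>.\<close>

lemma F_less_1: "F x < 1"
proof -
  have \<alpha>w: "\<alpha> * w < \<alpha>" using pmf_pos w_less_1 by simp
  have aux: "M < 1" if "m \<le> M" "M = x + \<alpha> * (M * w) + y * m" "\<alpha> + x + y = 1" "0 < x" "0 < y"
    for M m x y :: real
  proof (rule ccontr)
    assume "\<not> M < 1"
    then have M: "1 \<le> M" by simp
    have "M = x + (\<alpha> * w) * M + y * m" using that(2) by (simp add: mult_ac)
    also have "\<dots> < x * M + \<alpha> * M + y * M"
      using M that \<alpha>w by (intro add_less_le_mono add_le_less_mono mult_left_mono mult_strict_right_mono) auto
    also have "\<dots> = (\<alpha> + x + y) * M" by (simp add: algebra_simps)
    finally show False using that by simp
  qed
  have eqs: "F Lb = \<beta> + \<alpha> * (F Lb * w) + \<beta>' * F Lbar" "F Lbar = \<beta>' + \<alpha> * (F Lbar * w) + \<beta> * F Lb"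
    using F_eqs(2,3) by (simp_all only: F_simps(1))
  have "F Lb < 1 \<and> F Lbar < 1"
  proof (cases "F Lbar \<le> F Lb")
    case True
    moreover have "F Lb < 1"
      by (rule aux[OF True eqs(1)]) (use pmf_sum pmf_pos in auto)
    ultimately show ?thesis by (simp del: F_simps)
  next
    case False
    then have le: "F Lb \<le> F Lbar" by simp
    moreover have "F Lbar < 1"
      by (rule aux[OF le eqs(2)]) (use pmf_sum pmf_pos in auto)
    ultimately show ?thesis by (simp del: F_simps)
  qed
  then show ?thesis using w_less_1 by (cases x) auto
qed

text \<open>For reduced \<open>z\<close> this is the probability that the walk started at
  \<open>z\<close> ever visits the identity: the letters have to be removed from the right one by
  one, and removing a letter means covering the displacement by its inverse.\<close>

definition hit :: "letter list \<Rightarrow> real"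
  where "hit z = prod_list (map (\<lambda>x. F (inv_letter x)) z)"

lemma hit_simps [simp]:
  "hit [] = 1" "hit (x # z) = F (inv_letter x) * hit z" "hit (u @ v) = hit u * hit v"
  by (simp_all add: hit_def)

lemma hit_nonneg: "0 \<le> hit z"
  using F_pos by (induction z) (auto simp: less_imp_le)

lemma hit_bound:
  obtains \<kappa> where "0 < \<kappa>" "\<kappa> < 1" "\<And>z. hit z \<le> \<kappa> ^ length z"
proof
  define \<kappa> where "\<kappa> = Max {F La, F Lb, F Lbar}"
  have F: "F x \<le> \<kappa>" for x by (cases x) (auto simp: \<kappa>_def simp del: F_simps)
  show "0 < \<kappa>" using F[of La] F_pos[of La] by simp
  then show "hit z \<le> \<kappa> ^ length z" for z
    by (induction z) (auto intro!: mult_mono F hit_nonneg)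
  show "\<kappa> < 1" unfolding \<kappa>_def using F_less_1 by (simp del: F_simps)
qed

lemma hit_le_1: "hit z \<le> 1"
  using hit_nonneg F_less_1 F_pos by (induction z) (auto simp: mult_le_one less_imp_le)

text \<open>A step affects only the end of the word, so \<open>hit u\<close> factors out, and the
  first-step equation for the inverse of the last letter remains.\<close>

lemma hit_harmonic:
  assumes "z \<in> words" "z \<noteq> []"
  shows "\<alpha> * hit (foldr lmult z [La]) + \<beta> * hit (foldr lmult z [Lb]) +
    \<beta>' * hit (foldr lmult z [Lbar]) = hit z"
proof -
  obtain u y where z: "z = u @ [y]" using assms(2) by (cases z rule: rev_cases) auto
  note step = foldr_lmult_snoc[OF assms(1)[unfolded z]]
  show ?thesis
  proof (cases y)
    case La
    have "\<alpha> * hit (foldr lmult z [La]) + \<beta> * hit (foldr lmult z [Lb]) + \<beta>' * hit (foldr lmult z [Lbar]) =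
      hit u * (\<alpha> + \<beta> * (F La * F Lbar) + \<beta>' * (F La * F Lb))"
      unfolding z step by (simp add: La alternates_def algebra_simps del: F_simps)
    then show ?thesis unfolding F_eqs(1)[symmetric] by (simp add: z La)
  next
    case Lb
    have "\<alpha> * hit (foldr lmult z [La]) + \<beta> * hit (foldr lmult z [Lb]) + \<beta>' * hit (foldr lmult z [Lbar]) =
      hit u * (\<beta>' + \<alpha> * (F Lbar * F La) + \<beta> * F Lb)"
      unfolding z step by (simp add: Lb alternates_def algebra_simps del: F_simps)
    then show ?thesis unfolding F_eqs(3)[symmetric] by (simp add: z Lb)
  next
    case Lbar
    have "\<alpha> * hit (foldr lmult z [La]) + \<beta> * hit (foldr lmult z [Lb]) + \<beta>' * hit (foldr lmult z [Lbar]) =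
      hit u * (\<beta> + \<alpha> * (F Lb * F La) + \<beta>' * F Lbar)"
      unfolding z step by (simp add: Lbar alternates_def algebra_simps del: F_simps)
    then show ?thesis unfolding F_eqs(2)[symmetric] by (simp add: z Lbar)
  qed
qed

section \<open>The harmonic function with boundary values the indicator of first letter a\<close>

definition p :: real
  where "p = w / (1 + w)"

text \<open>\<open>p\<close> and \<open>s\<close> are the probabilities that the limit starts with
  a, respectively with b or b^{-1}. To reach the former set the walk must visit a, and translation
  by a exchanges the two sets; hence \<open>p = w * s\<close>.\<close>

definition s :: real
  where "s = 1 / (1 + w)"

lemma p_s: "0 < p" "0 < s" "p = w * s" "p + s = 1" "p < 1"
  using w_pos by (auto simp: p_def s_def field_simps)

text \<open>The probability that the walk started at \<open>z\<close> converges to a point with first letter \<open>a\<close>.\<close>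

definition to_La :: "letter list \<Rightarrow> real"
  where "to_La z = (if z \<noteq> [] \<and> hd z = La then 1 - p * hit (tl z) else p * hit z)"

lemma to_La_bounds: "0 \<le> to_La z" "to_La z \<le> 1"
proof -
  have "0 \<le> p * hit y" "p * hit y \<le> 1" for y
    using p_s hit_nonneg[of y] hit_le_1[of y] by (auto simp: mult_le_one)
  then show "0 \<le> to_La z" "to_La z \<le> 1" by (auto simp: to_La_def)
qed

text \<open>Unless \<open>z\<close> is the identity or [a], no step crosses the edge joining these
  two, and harmonicity is inherited from \<open>hit\<close> or from its complement. The two ends of
  the edge are what \<open>p\<close> is adjusted to.\<close>

lemma to_La_harmonic:
  assumes z: "z \<in> words"
  shows "\<alpha> * to_La (foldr lmult z [La]) + \<beta> * to_La (foldr lmult z [Lb]) +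
    \<beta>' * to_La (foldr lmult z [Lbar]) = to_La z"
proof -
  \<comment> \<open>The mean value property at the identity, which reduces to \<open>w_eq\<close>;
    the one at [a] is its complement.\<close>
  have edge: "\<alpha> * (1 - p) + \<beta> * (p * F Lbar) + \<beta>' * (p * F Lb) = p"
  proof -
    have "p * F Lbar = s * (1 - r)" "p * F Lb = s * r" "1 - p = s"
      using p_s w_pos by simp_all
    then have "\<alpha> * (1 - p) + \<beta> * (p * F Lbar) + \<beta>' * (p * F Lb) = s * (\<alpha> + \<beta> * (1 - r) + \<beta>' * r)"
      by (simp only: distrib_left mult_ac)
    also have "\<dots> = p" using p_s(3) by (simp add: w_eq[symmetric])
    finally show ?thesis .
  qed
  have compl: "\<alpha> * (1 - a) + \<beta> * (1 - b) + \<beta>' * (1 - c) = 1 - (\<alpha> * a + \<beta> * b + \<beta>' * c)" for a b c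
    using pmf_sum by (simp add: algebra_simps)
  consider "z = []" | "z = [La]" | y where "z = La # y" "y \<noteq> []" | "z \<noteq> []" "hd z \<noteq> La"
    by (cases z; cases "hd z = La"; cases "tl z") auto
  then show ?thesis
  proof cases
    case 1
    then show ?thesis using edge by (simp add: to_La_def)
  next
    case 2
    have "\<alpha> * p + \<beta> * (1 - p * F Lbar) + \<beta>' * (1 - p * F Lb) = 1 - p"
      using edge compl[of "1 - p" "p * F Lbar" "p * F Lb"] by simp
    with 2 show ?thesis by (simp add: to_La_def)
  next
    case 3
    obtain u c where y: "y = u @ [c]" using 3(2) by (cases y rule: rev_cases) auto
    have yw: "y \<in> words" using z 3 words_ConsD by blast
    have "to_La (foldr lmult z [x]) = 1 - p * hit (foldr lmult y [x])" for x
    proof -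
      have "z = (La # u) @ [c]" using 3 y by simp
      then show ?thesis
        using foldr_lmult_snoc[of "La # u" c x] foldr_lmult_snoc[of u c x] z yw y
        by (simp add: to_La_def del: foldr_append)
    qed
    then show ?thesis
      using hit_harmonic[OF yw 3(2)] 3
      by (simp add: compl to_La_def mult.left_commute[of _ p] distrib_left[symmetric] del: distrib_left)
  next
    case 4
    obtain u c where y: "z = u @ [c]" using 4(1) by (cases z rule: rev_cases) auto
    have "to_La (foldr lmult z [x]) = p * hit (foldr lmult z [x])" for x
    proof -
      have "foldr lmult z [x] = [] \<or> hd (foldr lmult z [x]) \<noteq> La"
        using 4 z unfolding y foldr_lmult_snoc[OF z[unfolded y]] by (cases u) auto
      then show ?thesis by (auto simp: to_La_def)
    qed
    then show ?thesis
      using hit_harmonic[OF z 4(1)] 4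
      by (simp add: to_La_def mult.left_commute[of _ p] distrib_left[symmetric] del: distrib_left)
  qed
qed

text \<open>The translated walk also has length tending to infinity, so the \<open>hit\<close> term
  vanishes in the limit; the branch taken by \<open>to_La\<close> eventually records whether the
  limit lies in the cylinder.\<close>

lemma to_La_walk_tendsto:
  assumes v: "v @ [La] \<in> words" and h: "\<And>n. h n \<in> words"
    and len: "filterlim (\<lambda>n. length (walk h n)) at_top sequentially"
    and conv: "converges_to (walk h) \<gamma>"
  shows "(\<lambda>n. to_La (foldr lmult (inv_word v) (walk h n))) \<longlonglongrightarrow> indicator (cylinder (v @ [La])) \<gamma>"
proof -
  obtain \<kappa> where \<kappa>: "0 < \<kappa>" "\<kappa> < 1" "\<And>z. hit z \<le> \<kappa> ^ length z"
    by (rule hit_bound) auto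
  define z where "z n = foldr lmult (inv_word v) (walk h n)" for n
  have W: "walk h n \<in> words" for n using h by (rule walk_in_words)
  have len_z: "length (walk h n) - length v \<le> length (z n)" for n
    unfolding z_def by (rule length_inv_word_lmult_ge[OF W])
  \<comment> \<open>One letter is subtracted because \<open>to_La\<close> applies \<open>hit\<close>
    to the tail when the word starts with a.\<close>
  have "filterlim (\<lambda>n. length (z n) - 1) at_top sequentially"
    unfolding filterlim_at_top
  proof
    fix K
    from len have "eventually (\<lambda>n. K + length v + 1 \<le> length (walk h n)) sequentially"
      unfolding filterlim_at_top by blast
    then show "eventually (\<lambda>n. K \<le> length (z n) - 1) sequentially"
    proof eventually_elim
      case (elim n)
      with len_z[of n] show ?case by linarith
    qed
  qed
  then have "(\<lambda>n. \<kappa> ^ (length (z n) - 1)) \<longlonglongrightarrow> 0"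
    using \<kappa> by (intro filterlim_compose[OF LIMSEQ_power_zero[of \<kappa>]]) auto
  moreover have "eventually (\<lambda>n. norm (to_La (z n) - indicator (cylinder (v @ [La])) \<gamma>) \<le>
      \<kappa> ^ (length (z n) - 1)) sequentially"
  proof -
    have "eventually (\<lambda>n. take (Suc (length v)) (walk h n) = map \<gamma> [0..<Suc (length v)]) sequentially"
      using conv unfolding converges_to_def by blast
    then show ?thesis
    proof eventually_elim
      case (elim n)
      have "\<gamma> \<in> cylinder (v @ [La]) \<longleftrightarrow> take (Suc (length v)) (walk h n) = v @ [La]"
        using conv elim by (auto simp: cylinder_def converges_to_def)
      also have "\<dots> \<longleftrightarrow> z n \<noteq> [] \<and> hd (z n) = La"
        unfolding prefix_iff_starts_with_La[OF v W] z_def[symmetric] by (cases "z n") auto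
      finally have cyl: "\<gamma> \<in> cylinder (v @ [La]) \<longleftrightarrow> z n \<noteq> [] \<and> hd (z n) = La" .
      have p: "norm (p * hit y) \<le> \<kappa> ^ (length (z n) - 1)" if "length (z n) - 1 \<le> length y" for y
      proof -
        have "norm (p * hit y) \<le> 1 * hit y"
          using p_s(1,5) hit_nonneg[of y] by (simp add: mult_left_le_one_le)
        also have "\<dots> \<le> \<kappa> ^ length y" using \<kappa> by simp
        also have "\<dots> \<le> \<kappa> ^ (length (z n) - 1)" using that \<kappa> by (intro power_decreasing) auto
        finally show ?thesis .
      qed
      show ?case
      proof (cases "z n \<noteq> [] \<and> hd (z n) = La")
        case True
        then show ?thesis using p[of "tl (z n)"] cyl by (simp add: to_La_def)
      next
        case False
        then show ?thesis using p[of "z n"] cyl by (auto simp: to_La_def)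
      qed
    qed
  qed
  ultimately have "(\<lambda>n. to_La (z n) - indicator (cylinder (v @ [La])) \<gamma>) \<longlonglongrightarrow> 0"
    by (rule Lim_null_comparison[rotated])
  then show ?thesis unfolding z_def using LIM_zero_iff by blast
qed

text \<open>Increments multiply on the right, so translation by \<open>inv_word v\<close> on the
  left preserves harmonicity, and the single function \<open>to_La\<close> serves all cylinders.
  Dominated convergence with bound 1 identifies the constant expectation with the limit
  probability.\<close>

lemma emeasure_cylinder_snoc_La:
  assumes v: "v @ [La] \<in> words"
  shows "emeasure (harmonic_measure \<mu>) (cylinder (v @ [La])) = ennreal (to_La (inv_word v))"
proof -
  interpret I: prob_space "increments \<mu>" by simp
  let ?u = "\<lambda>z. ennreal (to_La z)"
  have iv: "inv_word v \<in> words" using v words_appendD(1) inv_word_in_words by blast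
  have u: "(\<integral>\<^sup>+x. ?u (foldr lmult z x) \<partial>measure_pmf \<mu>) = ?u z" if "z \<in> words" for z
    using to_La_harmonic[OF that] by (simp add: nn_integral_letters to_La_bounds del: ennreal_plus)
  have "(\<lambda>n. \<integral>\<^sup>+h. ?u (foldr lmult (inv_word v) (walk h n)) \<partial>increments \<mu>) \<longlonglongrightarrow>
    (\<integral>\<^sup>+h. indicator (cylinder (v @ [La])) (boundary_limit (walk h)) \<partial>increments \<mu>)"
  proof (rule nn_integral_dominated_convergence[where w = "\<lambda>_. 1"])
    show "(\<lambda>h. ?u (foldr lmult (inv_word v) (walk h n))) \<in> borel_measurable (increments \<mu>)" for n
      by (rule measurable_compose[OF walk_measurable]) simp
    show "(\<lambda>h. indicator (cylinder (v @ [La])) (boundary_limit (walk h))) \<in> borel_measurable (increments \<mu>)"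
      by (rule measurable_compose[OF boundary_limit_walk_measurable]) simp
    show "AE h in increments \<mu>. (\<lambda>n. ?u (foldr lmult (inv_word v) (walk h n))) \<longlonglongrightarrow>
        indicator (cylinder (v @ [La])) (boundary_limit (walk h))"
      using AE_length_walk_at_top AE_converges AE_increments[OF set_pmf_words]
    proof eventually_elim
      case (elim h)
      then obtain \<gamma> where \<gamma>: "converges_to (walk h) \<gamma>" by blast
      have "(\<lambda>n. to_La (foldr lmult (inv_word v) (walk h n))) \<longlonglongrightarrow> indicator (cylinder (v @ [La])) \<gamma>"
        using elim by (intro to_La_walk_tendsto v \<gamma>) auto
      then have "(\<lambda>n. ?u (foldr lmult (inv_word v) (walk h n))) \<longlonglongrightarrow>
          ennreal (indicator (cylinder (v @ [La])) \<gamma>)"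
        by (rule tendsto_ennrealI)
      then show ?case by (simp add: boundary_limit_eqI[OF \<gamma>] ennreal_indicator)
    qed
  qed (auto simp: I.emeasure_space_1 to_La_bounds)
  moreover have "(\<integral>\<^sup>+h. ?u (foldr lmult (inv_word v) (walk h n)) \<partial>increments \<mu>) = ?u (inv_word v)" for n
    by (rule nn_integral_walk_harmonic[OF set_pmf_words u iv])
  ultimately have "?u (inv_word v) =
      (\<integral>\<^sup>+h. indicator (cylinder (v @ [La])) (boundary_limit (walk h)) \<partial>increments \<mu>)"
    by (simp add: LIMSEQ_const_iff)
  then show ?thesis by (simp add: emeasure_harmonic_measure)
qed

text \<open>In va every b-letter is followed by an a, and such pairs contribute
  \<open>F Lb * w = r\<close> or \<open>F Lbar * w = 1 - r\<close>. Only an a at the front stays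
  unpaired.\<close>

lemma prod_F_snoc_La:
  assumes "v @ [La] \<in> words"
  shows "prod_list (map F v) * w =
    (if hd (v @ [La]) = La then w else 1) * prod_list (map (ratio_weight r) v)"
  using assms
proof (induction v)
  case (Cons x v)
  have IH: "prod_list (map F v) * w =
      (if hd (v @ [La]) = La then w else 1) * prod_list (map (ratio_weight r) v)"
    using Cons words_ConsD by simp
  have "alternates x (hd (v @ [La]))"
    using Cons.prems by (cases v) (auto simp: words_Cons2)
  with IH w_pos show ?case by (cases x) (auto simp: alternates_def field_simps)
qed simp

lemma emeasure_cylinder:
  assumes u: "u \<in> words" "u \<noteq> []"
  shows "emeasure (harmonic_measure \<mu>) (cylinder u) =
    ennreal ((if hd u = La then p else s) * prod_list (map (ratio_weight r) u))"
proof -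
  have La: "emeasure (harmonic_measure \<mu>) (cylinder (v @ [La])) =
    ennreal ((if hd (v @ [La]) = La then p else s) * prod_list (map (ratio_weight r) v))"
    if v: "v @ [La] \<in> words" for v
  proof -
    \<comment> \<open>As va is reduced, \<open>v\<close> does not end in a, so the second branch of
      \<open>to_La\<close> applies.\<close>
    have "inv_word v = [] \<or> hd (inv_word v) \<noteq> La"
      using v by (cases v rule: rev_cases) (auto simp: inv_word_def words_snoc2 alternates_def)
    then have "to_La (inv_word v) = p * prod_list (map F v)"
      by (auto simp: to_La_def hit_def inv_word_def o_def rev_map[symmetric] prod_list.rev)
    also have "\<dots> = s * (prod_list (map F v) * w)" using p_s(3) by simp
    also have "\<dots> = (if hd (v @ [La]) = La then p else s) * prod_list (map (ratio_weight r) v)"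
      unfolding prod_F_snoc_La[OF v] using p_s(3) by simp
    finally show ?thesis by (simp add: emeasure_cylinder_snoc_La[OF v])
  qed
  show ?thesis
  proof (cases "last u = La")
    case True
    then obtain v where "u = v @ [La]" using u(2) by (metis append_butlast_last_id)
    then show ?thesis using La[of v] u by simp
  next
    case False
    have "u @ [La] \<in> words"
      using u False by (cases u rule: rev_cases) (auto simp: words_snoc2 alternates_def)
    then show ?thesis using La[of u] u False by (simp add: cylinder_snoc_La)
  qed
qed

end

section \<open>Cylinders generate the Borel sets\<close>

lemma map_boundary_in_words: "\<gamma> \<in> boundary \<Longrightarrow> map \<gamma> [0..<n] \<in> words"
  by (auto simp: words_def boundary_def successively_conv_nth)

lemma cylinder_Int:
  assumes "length u \<le> length v"
  shows "cylinder u \<inter> cylinder v = (if take (length u) v = u then cylinder v else {})"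
proof -
  have "\<gamma> \<in> cylinder u \<longleftrightarrow> take (length u) v = u" if \<gamma>: "\<gamma> \<in> cylinder v" for \<gamma>
  proof -
    have v: "map \<gamma> [0..<length v] = v" using \<gamma> by (simp add: cylinder_def)
    have "take (length u) (map \<gamma> [0..<length v]) = map \<gamma> [0..<length u]"
      using assms by (simp add: take_map)
    then have "map \<gamma> [0..<length u] = take (length u) v" unfolding v by simp
    with \<gamma> show ?thesis by (simp add: cylinder_def)
  qed
  then show ?thesis by auto
qed

lemma open_contains_cylinder:
  assumes "open S" "\<gamma> \<in> S"
  shows "\<exists>n. cylinder (map \<gamma> [0..<Suc n]) \<subseteq> S"
proof -
  have "openin (product_topology (\<lambda>i. euclidean) UNIV) S"
    using assms(1) by (simp add: open_fun_def)
  from product_topology_open_contains_basis[OF this assms(2)]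
  obtain X where X: "\<gamma> \<in> (\<Pi>\<^sub>E i\<in>UNIV. X i)" "finite {i. X i \<noteq> UNIV}" "(\<Pi>\<^sub>E i\<in>UNIV. X i) \<subseteq> S"
    by auto
  \<comment> \<open>Inserting 0 gives the maximum a meaning even if no coordinate is
    restricted.\<close>
  define n where "n = Max (insert 0 {i. X i \<noteq> UNIV})"
  have n: "X i = UNIV" if "n < i" for i
    using that X(2) Max_ge[of "insert 0 {i. X i \<noteq> UNIV}" i] by (auto simp: n_def)
  have "cylinder (map \<gamma> [0..<Suc n]) \<subseteq> (\<Pi>\<^sub>E i\<in>UNIV. X i)"
  proof
    fix \<eta> assume "\<eta> \<in> cylinder (map \<gamma> [0..<Suc n])"
    then have "map \<eta> [0..<Suc n] = map \<gamma> [0..<Suc n]"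
      by (simp add: cylinder_def del: upt_Suc)
    then have "\<eta> i = \<gamma> i" if "i \<le> n" for i
      using that by (auto simp del: upt_Suc)
    then have "\<eta> i \<in> X i" for i
      using X(1) n[of i] by (cases "i \<le> n") (auto simp: PiE_iff)
    then show "\<eta> \<in> (\<Pi>\<^sub>E i\<in>UNIV. X i)" by (simp add: PiE_iff)
  qed
  with X(3) show ?thesis by blast
qed

text \<open>The empty set makes the family stable under intersection. Words are nonempty because the
  cylinder formula refers to the first letter.\<close>

definition cylinders :: "(nat \<Rightarrow> letter) set set"
  where "cylinders = insert {} (cylinder ` {u \<in> words. u \<noteq> []})"

lemma cylinder_in_cylinders: "u \<in> words \<Longrightarrow> u \<noteq> [] \<Longrightarrow> cylinder u \<in> cylinders"
  by (auto simp: cylinders_def)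

lemma Int_stable_cylinders: "Int_stable cylinders"
proof (rule Int_stableI)
  have le: "cylinder u \<inter> cylinder v \<in> cylinders"
    if "v \<in> words" "v \<noteq> []" "length u \<le> length v" for u v
    using that by (auto simp: cylinder_Int cylinders_def)
  fix A B assume "A \<in> cylinders" "B \<in> cylinders"
  then consider "A \<inter> B = {}" | u v where "A = cylinder u" "B = cylinder v" "u \<in> words" "u \<noteq> []"
      "v \<in> words" "v \<noteq> []"
    by (auto simp: cylinders_def)
  then show "A \<inter> B \<in> cylinders"
  proof cases
    case 1
    then show ?thesis by (simp add: cylinders_def)
  next
    case 2
    then show ?thesis
      using le[of v u] le[of u v] by (cases "length u \<le> length v") (auto simp: Int_commute)
  qed
qed

lemma space_boundary_borel [simp]: "space boundary_borel = boundary"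
  by (simp add: boundary_borel_def space_restrict_space)

lemma cylinders_subset: "cylinders \<subseteq> Pow boundary"
  by (auto simp: cylinders_def cylinder_def)

text \<open>There are only countably many words, so the trace of an open set on the boundary is a
  countable union of cylinders; this makes the identity measurable from the generated algebra to the
  Borel sets.\<close>

lemma sets_boundary_borel: "sets boundary_borel = sigma_sets boundary cylinders"
proof
  have "cylinders \<subseteq> sets boundary_borel" by (auto simp: cylinders_def)
  then show "sigma_sets boundary cylinders \<subseteq> sets boundary_borel"
    using sets.sigma_sets_subset[of cylinders boundary_borel] by simp
next
  define N where "N = sigma boundary cylinders"
  have N: "space N = boundary" "sets N = sigma_sets boundary cylinders"
    using cylinders_subset by (auto simp: N_def)
  have "(\<lambda>\<gamma>. \<gamma>) \<in> borel_measurable N"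
  proof (rule borel_measurableI)
    fix S :: "(nat \<Rightarrow> letter) set" assume S: "open S"
    have "S \<inter> boundary = (\<Union>u\<in>{u \<in> words. u \<noteq> [] \<and> cylinder u \<subseteq> S}. cylinder u)"
    proof (intro equalityI subsetI)
      fix \<gamma> assume "\<gamma> \<in> S \<inter> boundary"
      then obtain n where n: "cylinder (map \<gamma> [0..<Suc n]) \<subseteq> S" "\<gamma> \<in> boundary"
        using open_contains_cylinder[OF S] by blast
      then have "\<gamma> \<in> cylinder (map \<gamma> [0..<Suc n])" by (simp add: cylinder_def)
      with n show "\<gamma> \<in> (\<Union>u\<in>{u \<in> words. u \<noteq> [] \<and> cylinder u \<subseteq> S}. cylinder u)"
        using map_boundary_in_words[OF n(2), of "Suc n"]
        by (intro UN_I[of "map \<gamma> [0..<Suc n]"]) auto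
    qed (auto simp: cylinder_def)
    also have "\<dots> \<in> sets N"
      by (intro sets.countable_UN') (auto simp: N intro!: sigma_sets.Basic cylinder_in_cylinders)
    finally show "(\<lambda>\<gamma>. \<gamma>) -` S \<inter> space N \<in> sets N" by (simp add: N(1))
  qed
  then have "B \<inter> boundary \<in> sets N" if "B \<in> sets borel" for B
    using measurable_sets[of "\<lambda>\<gamma>. \<gamma>" N borel B] that by (simp add: N(1))
  then show "sets boundary_borel \<subseteq> sigma_sets boundary cylinders"
    unfolding N(2)[symmetric] by (auto simp: boundary_borel_def sets_restrict_space Int_commute)
qed

lemma boundary_eq_UN_cylinder:
  "boundary = (\<Union>u\<in>{u \<in> words. length u = Suc n}. cylinder u)"
proof (intro equalityI subsetI)
  fix \<gamma> assume \<gamma>: "\<gamma> \<in> boundary"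
  then show "\<gamma> \<in> (\<Union>u\<in>{u \<in> words. length u = Suc n}. cylinder u)"
    using map_boundary_in_words[OF \<gamma>, of "Suc n"]
    by (intro UN_I[of "map \<gamma> [0..<Suc n]"]) (auto simp: cylinder_def)
qed (auto simp: cylinder_def)

section \<open>Equal ratios give equivalent harmonic measures\<close>

lemma sets_harmonic_measure [simp, measurable_cong]: "sets (harmonic_measure \<mu>) = sets boundary_borel"
  by (simp add: harmonic_measure_def)

lemma space_harmonic_measure [simp]: "space (harmonic_measure \<mu>) = boundary"
  by (simp add: harmonic_measure_def)

text \<open>For equal \<open>r\<close> the cylinder formulas differ only by the factor for the first
  letter. Hence the density takes one constant value on the cylinder of a and another off it, and
  agreement on the intersection-stable generator suffices.\<close>

lemma absolutely_continuous_harmonic_measure: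
  assumes "letter_walk_ratio \<mu> r" "letter_walk_ratio \<mu>' r"
  shows "absolutely_continuous (harmonic_measure \<mu>) (harmonic_measure \<mu>')"
proof -
  interpret A: letter_walk_ratio \<mu> r by fact
  interpret B: letter_walk_ratio \<mu>' r by fact
  define k where "k u = (if hd u = La then B.p / A.p else B.s / A.s)" for u :: "letter list"
  \<comment> \<open>\<open>[Lb]\<close> represents either first letter other than a.\<close>
  define f where "f \<gamma> = (if \<gamma> \<in> cylinder [La] then ennreal (k [La]) else ennreal (k [Lb]))" for \<gamma>
  have f: "f \<in> borel_measurable (harmonic_measure \<mu>)"
    unfolding f_def by measurable
  have f_cyl: "f \<gamma> = ennreal (k u)" if "\<gamma> \<in> cylinder u" "u \<noteq> []" for \<gamma> u
  proof -
    have "hd u = \<gamma> 0" "\<gamma> \<in> boundary"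
      using that by (auto simp: cylinder_def hd_conv_nth) (metis length_greater_0_conv nth_map_upt add_0 diff_zero)
    then show ?thesis by (simp add: f_def k_def cylinder_def)
  qed
  have "harmonic_measure \<mu>' = density (harmonic_measure \<mu>) f"
  proof (rule measure_eqI_generator_eq_countable[OF Int_stable_cylinders cylinders_subset])
    fix X assume "X \<in> cylinders"
    then consider "X = {}" | u where "X = cylinder u" "u \<in> words" "u \<noteq> []"
      by (auto simp: cylinders_def)
    then show "emeasure (harmonic_measure \<mu>') X = emeasure (density (harmonic_measure \<mu>) f) X"
    proof cases
      case 2
      have "emeasure (density (harmonic_measure \<mu>) f) X =
          (\<integral>\<^sup>+\<gamma>. ennreal (k u) * indicator (cylinder u) \<gamma> \<partial>harmonic_measure \<mu>)"
        unfolding 2(1) using f_cyl[OF _ 2(3)]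
        by (subst emeasure_density[OF f]) (auto intro!: nn_integral_cong simp: indicator_def)
      also have "\<dots> = ennreal (k u) * emeasure (harmonic_measure \<mu>) (cylinder u)"
        by (simp add: nn_integral_cmult_indicator)
      also have "\<dots> = emeasure (harmonic_measure \<mu>') (cylinder u)"
        using A.p_s(1,2) B.p_s(1,2) A.emeasure_cylinder[OF 2(2,3)] B.emeasure_cylinder[OF 2(2,3)]
        by (auto simp: k_def ennreal_mult'[symmetric])
      finally show ?thesis by (simp add: 2(1))
    qed simp
  next
    show "(\<Union>u\<in>{u \<in> words. length u = Suc 0}. cylinder u) = boundary"
      by (rule boundary_eq_UN_cylinder[symmetric])
    show "cylinder ` {u \<in> words. length u = Suc 0} \<subseteq> cylinders"
      by (intro image_subsetI cylinder_in_cylinders) auto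
    show "countable (cylinder ` {u \<in> words. length u = Suc 0})" by simp
    interpret prob_space "harmonic_measure \<mu>'" by (rule prob_space_harmonic_measure)
    show "emeasure (harmonic_measure \<mu>') X \<noteq> \<infinity>" for X by simp
  qed (simp_all add: sets_boundary_borel)
  then show ?thesis using absolutely_continuousI_density[OF f] by simp
qed

section \<open>Different ratios give singular harmonic measures\<close>

text \<open>Borel-Cantelli on both sides: the limit superior of the \<open>E n\<close> is null for
  \<open>M\<close>, and a point outside it lies in all but finitely many \<open>E n\<close>
  complements, whose limit superior is null for \<open>N\<close>.\<close>

lemma singular_measuresI:
  assumes "finite_measure M" "finite_measure N" and sets: "sets M = sets N"
    and E: "\<And>n. E n \<in> sets M" "\<And>n. measure M (E n) \<le> a n" "\<And>n. measure N (space N - E n) \<le> a n"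
    and a: "summable a"
  shows "singular_measures M N"
proof -
  interpret M: finite_measure M by fact
  interpret N: finite_measure N by fact
  have space: "space M = space N" using sets by (rule sets_eq_imp_space_eq)
  have summ: "summable (\<lambda>n. measure M (E n))" "summable (\<lambda>n. measure N (space N - E n))"
    by (auto intro!: summable_comparison_test'[OF a] E)
  have M0: "limsup E \<in> null_sets M"
    by (rule borel_cantelli_limsup1) (use E(1) summ in \<open>auto simp: M.emeasure_eq_measure\<close>)
  have "limsup (\<lambda>n. space N - E n) \<in> null_sets N"
    by (rule borel_cantelli_limsup1) (use E(1) summ sets in \<open>auto simp: N.emeasure_eq_measure\<close>)
  moreover have "space N - limsup E \<in> sets N"
    using M0 sets by auto
  moreover have "space N - limsup E \<subseteq> limsup (\<lambda>n. space N - E n)"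
  proof
    fix x assume x: "x \<in> space N - limsup E"
    then obtain n where "\<And>m. m \<ge> n \<Longrightarrow> x \<notin> E m" by (auto simp: limsup_INF_SUP)
    then have "x \<in> (SUP m\<in>{k..}. space N - E m)" for k
      using x by (auto intro!: bexI[of _ "max k n"])
    then show "x \<in> limsup (\<lambda>n. space N - E n)" by (auto simp: limsup_INF_SUP)
  qed
  ultimately have "space N - limsup E \<in> null_sets N"
    by (rule null_sets_subset)
  with M0 sets show ?thesis
    unfolding singular_measures_def by (intro conjI bexI[of _ "limsup E"]) auto
qed

lemma finite_words_of_length: "finite {u \<in> words. length u = n \<and> P u}"
proof (rule finite_subset)
  show "{u \<in> words. length u = n \<and> P u} \<subseteq> {u. set u \<subseteq> {La, Lb, Lbar} \<and> length u = n}"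
    using letter.exhaust by auto
qed (auto intro: finite_lists_length_eq)

text \<open>Prefixing a keeps a sum of products, and prefixing the b-letters multiplies it by
  \<open>\<theta>\<close>. Words of length 2m + 1 contain m letters from {b, b^{-1}} if they start
  with a and m + 1 otherwise.\<close>

lemma sum_prod_list_words:
  fixes \<psi> :: "letter \<Rightarrow> real"
  assumes "\<psi> La = 1"
  defines "\<theta> \<equiv> \<psi> Lb + \<psi> Lbar"
  shows "(\<Sum>u | u \<in> words \<and> length u = Suc (2 * m). prod_list (map \<psi> u)) = (1 + \<theta>) * \<theta> ^ m"
proof -
  define A where "A n = {u \<in> words. length u = Suc n \<and> hd u = La}" for n
  define B where "B n = {u \<in> words. length u = Suc n \<and> hd u \<noteq> La}" for n
  define S where "S U = (\<Sum>u\<in>U. prod_list (map \<psi> u))" for U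
  have fin: "finite (A n)" "finite (B n)" for n
    unfolding A_def B_def by (rule finite_words_of_length)+
  have disj: "A n \<inter> B n = {}" for n by (auto simp: A_def B_def)
  have S_Cons: "S ((#) x ` U) = \<psi> x * S U" for x U
    by (simp add: S_def sum.reindex sum_distrib_left)
  have A0: "A 0 = {[La]}" by (auto simp: A_def length_Suc_conv)
  have B0: "B 0 = {[Lb], [Lbar]}"
    by (auto simp: B_def length_Suc_conv intro: letter.exhaust)
  have A_Suc: "A (Suc n) = (#) La ` B n" for n
    by (fastforce simp: A_def B_def length_Suc_conv words_Cons2 alternates_def image_iff)
  have B_Suc: "B (Suc n) = (#) Lb ` A n \<union> (#) Lbar ` A n" for n
  proof (intro equalityI subsetI)
    fix u assume "u \<in> B (Suc n)"
    then obtain x y v where "u = x # y # v" "x \<noteq> La" "y # v \<in> A n"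
      by (auto simp: A_def B_def length_Suc_conv words_Cons2 alternates_def)
    then show "u \<in> (#) Lb ` A n \<union> (#) Lbar ` A n" by (cases x) auto
  qed (auto simp: A_def B_def length_Suc_conv words_Cons2 alternates_def)
  have SA: "S (A (Suc n)) = S (B n)" for n by (simp add: A_Suc S_Cons assms)
  have SB: "S (B (Suc n)) = \<theta> * S (A n)" for n
  proof -
    have "S (B (Suc n)) = S ((#) Lb ` A n) + S ((#) Lbar ` A n)"
      unfolding B_Suc S_def by (rule sum.union_disjoint) (auto simp: fin)
    then show ?thesis by (simp add: S_Cons \<theta>_def algebra_simps)
  qed
  have "S (A (2 * m)) = \<theta> ^ m \<and> S (B (2 * m)) = \<theta> * \<theta> ^ m"
  proof (induction m)
    case 0
    show ?case by (simp add: A0 B0 S_def assms \<theta>_def)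
  next
    case (Suc m)
    then show ?case by (simp add: SA SB)
  qed
  moreover have "{u. u \<in> words \<and> length u = Suc (2 * m)} = A (2 * m) \<union> B (2 * m)"
    by (auto simp: A_def B_def)
  moreover have "S (A (2 * m) \<union> B (2 * m)) = S (A (2 * m)) + S (B (2 * m))"
    unfolding S_def by (rule sum.union_disjoint[OF fin disj])
  ultimately show ?thesis by (simp add: S_def algebra_simps)
qed

lemma sqrt_mult_less_mean:
  fixes x y :: real
  assumes "0 \<le> x" "0 \<le> y" "x \<noteq> y"
  shows "sqrt (x * y) < (x + y) / 2"
proof -
  have "0 < (sqrt x - sqrt y)\<^sup>2" using assms by simp
  also have "(sqrt x - sqrt y)\<^sup>2 = x + y - 2 * sqrt (x * y)"
    using assms by (simp add: power2_diff real_sqrt_mult)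
  finally show ?thesis by simp
qed

text \<open>The set where, at level \<open>n\<close>, the first measure gives the smaller weight has first measure and
  complementary second measure at most the Hellinger affinity of the two measures at this level, and
  that decays geometrically.\<close>

lemma singular_harmonic_measure:
  assumes "letter_walk_ratio \<mu> r" "letter_walk_ratio \<mu>' r'" "r \<noteq> r'"
  shows "singular_measures (harmonic_measure \<mu>) (harmonic_measure \<mu>')"
proof -
  interpret A: letter_walk_ratio \<mu> r by fact
  interpret B: letter_walk_ratio \<mu>' r' by fact
  interpret HA: prob_space "harmonic_measure \<mu>" by (rule prob_space_harmonic_measure)
  interpret HB: prob_space "harmonic_measure \<mu>'" by (rule prob_space_harmonic_measure)
  define \<psi> where "\<psi> x = sqrt (ratio_weight r x * ratio_weight r' x)" for x
  define \<theta> where "\<theta> = \<psi> Lb + \<psi> Lbar"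
  have weight: "0 \<le> ratio_weight r x" "0 \<le> ratio_weight r' x" for x
    using A.r B.r by (cases x; simp)+
  \<comment> \<open>\<open>\<theta>\<close> is the affinity of the two laws of a single b-letter;
    the strict inequality of means bounds it by ((r + r') + (2 - r - r')) / 2 = 1.\<close>
  have \<theta>: "0 \<le> \<theta>" "\<theta> < 1"
    using sqrt_mult_less_mean[of r r'] sqrt_mult_less_mean[of "1 - r" "1 - r'"] A.r B.r assms(3)
    by (auto simp: \<theta>_def \<psi>_def)
  define a where "a u = measure (harmonic_measure \<mu>) (cylinder u)" for u
  define b where "b u = measure (harmonic_measure \<mu>') (cylinder u)" for u
  have ab: "sqrt (a u * b u) \<le> prod_list (map \<psi> u)" if u: "u \<in> words" "u \<noteq> []" for u
  proof -
    have nonneg: "0 \<le> prod_list (map (ratio_weight r) u)" "0 \<le> prod_list (map (ratio_weight r') u)"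
      using weight by (auto intro!: prod_list_nonneg)
    have le: "k * x \<le> x" if "k \<le> 1" "0 \<le> x" for k x :: real
      using that mult_right_mono[of k 1 x] by simp
    have "a u = (if hd u = La then A.p else A.s) * prod_list (map (ratio_weight r) u)"
      using A.emeasure_cylinder[OF u] A.p_s nonneg by (auto simp: a_def HA.emeasure_eq_measure)
    also have "\<dots> \<le> prod_list (map (ratio_weight r) u)"
      using A.p_s nonneg by (intro le) auto
    finally have a: "a u \<le> prod_list (map (ratio_weight r) u)" .
    have "b u = (if hd u = La then B.p else B.s) * prod_list (map (ratio_weight r') u)"
      using B.emeasure_cylinder[OF u] B.p_s nonneg by (auto simp: b_def HB.emeasure_eq_measure)
    also have "\<dots> \<le> prod_list (map (ratio_weight r') u)"
      using B.p_s nonneg by (intro le) auto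
    finally have b: "b u \<le> prod_list (map (ratio_weight r') u)" .
    have "sqrt (a u * b u) \<le> sqrt (prod_list (map (ratio_weight r) u) * prod_list (map (ratio_weight r') u))"
      using a b nonneg by (intro real_sqrt_le_mono mult_mono) (auto simp: b_def)
    also have "\<dots> = prod_list (map \<psi> u)"
      by (induction u) (simp_all add: \<psi>_def real_sqrt_mult mult_ac)
    finally show ?thesis .
  qed
  define U where "U m = {u \<in> words. length u = Suc (2 * m)}" for m :: nat
  have U: "u \<in> words" "u \<noteq> []" if "u \<in> U m" for u m using that by (auto simp: U_def)
  have fin: "finite (U m)" for m
    using finite_words_of_length[of "Suc (2 * m)" "\<lambda>_. True"] by (simp add: U_def)
  define E where "E m = (\<Union>u\<in>{u \<in> U m. a u \<le> b u}. cylinder u)" for m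
  have sum_U: "(\<Sum>u\<in>U m. prod_list (map \<psi> u)) = (1 + \<theta>) * \<theta> ^ m" for m
    unfolding U_def \<theta>_def by (subst sum_prod_list_words[symmetric]) (auto simp: \<psi>_def)
  \<comment> \<open>This is applied with \<open>c\<close> the smaller of the two weights, which
    never exceeds their geometric mean.\<close>
  have sum_le: "(\<Sum>u\<in>V. c u) \<le> (1 + \<theta>) * \<theta> ^ m"
    if "V \<subseteq> U m" and c: "\<And>u. u \<in> V \<Longrightarrow> c u \<le> sqrt (a u * b u)" for V c m
  proof -
    have "(\<Sum>u\<in>V. c u) \<le> (\<Sum>u\<in>V. prod_list (map \<psi> u))"
      using that ab U by (intro sum_mono) (meson order_trans subsetD)
    also have "\<dots> \<le> (\<Sum>u\<in>U m. prod_list (map \<psi> u))"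
      using that weight fin by (intro sum_mono2) (auto intro!: prod_list_nonneg simp: \<psi>_def)
    finally show ?thesis by (simp add: sum_U)
  qed
  show ?thesis
  proof (rule singular_measuresI[where E = E and a = "\<lambda>m. (1 + \<theta>) * \<theta> ^ m"])
    fix m
    show "E m \<in> sets (harmonic_measure \<mu>)"
      using fin by (auto simp: E_def)
    have "measure (harmonic_measure \<mu>) (E m) \<le> (\<Sum>u\<in>{u \<in> U m. a u \<le> b u}. a u)"
      unfolding E_def a_def using fin by (intro HA.finite_measure_subadditive_finite) auto
    also have "\<dots> \<le> (1 + \<theta>) * \<theta> ^ m"
    proof (rule sum_le)
      fix u assume "u \<in> {u \<in> U m. a u \<le> b u}"
      then show "a u \<le> sqrt (a u * b u)"
        by (intro real_le_rsqrt) (auto simp: power2_eq_square a_def intro: mult_left_mono)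
    qed auto
    finally show "measure (harmonic_measure \<mu>) (E m) \<le> (1 + \<theta>) * \<theta> ^ m" .
    have "measure (harmonic_measure \<mu>') (space (harmonic_measure \<mu>') - E m) \<le>
        measure (harmonic_measure \<mu>') (\<Union>u\<in>{u \<in> U m. b u < a u}. cylinder u)"
    proof (rule HB.finite_measure_mono)
      show "space (harmonic_measure \<mu>') - E m \<subseteq> (\<Union>u\<in>{u \<in> U m. b u < a u}. cylinder u)"
      proof
        fix \<gamma> assume \<gamma>: "\<gamma> \<in> space (harmonic_measure \<mu>') - E m"
        then obtain u where u: "u \<in> U m" "\<gamma> \<in> cylinder u"
          using boundary_eq_UN_cylinder[of "2 * m"] by (auto simp: U_def)
        with \<gamma> have "b u < a u" by (auto simp: E_def not_le[symmetric])
        with u show "\<gamma> \<in> (\<Union>u\<in>{u \<in> U m. b u < a u}. cylinder u)" by blast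
      qed
    qed (use fin in auto)
    also have "\<dots> \<le> (\<Sum>u\<in>{u \<in> U m. b u < a u}. b u)"
      unfolding b_def using fin by (intro HB.finite_measure_subadditive_finite) auto
    also have "\<dots> \<le> (1 + \<theta>) * \<theta> ^ m"
    proof (rule sum_le)
      fix u assume "u \<in> {u \<in> U m. b u < a u}"
      then show "b u \<le> sqrt (a u * b u)"
        by (intro real_le_rsqrt) (auto simp: power2_eq_square b_def intro: mult_right_mono)
    qed auto
    finally show "measure (harmonic_measure \<mu>') (space (harmonic_measure \<mu>') - E m) \<le> (1 + \<theta>) * \<theta> ^ m" .
  next
    show "summable (\<lambda>m. (1 + \<theta>) * \<theta> ^ m)"
      using \<theta> by (intro summable_mult summable_geometric) auto
  qed (unfold_locales, simp)
qed

section \<open>The example\<close>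

lemma (in letter_walk) nondegenerate: "nondegenerate \<mu>"
proof -
  have supp: "[x] \<in> set_pmf \<mu>" for x
    using pmf_pos by (cases x) (auto simp: set_pmf_iff)
  let ?G = "semigroup_generated Gamma_grp (set_pmf \<mu>)"
  have mult: "foldr lmult u v \<in> ?G" if "u \<in> ?G" "v \<in> ?G" for u v
    using semigroup_generated.mult[OF that] by (simp add: Gamma_grp_def)
  have letter: "[x] \<in> ?G" for x using supp by (rule semigroup_generated.incl)
  have "u \<in> words" if "u \<in> ?G" for u
    using that
  proof induction
    case (incl u)
    then show ?case using set_pmf_words by auto
  next
    case (mult u v)
    then show ?case by (simp add: Gamma_grp_def foldr_lmult_in_words)
  qed
  moreover have "u \<in> ?G" if "u \<in> words" for u
    using that
  proof (induction u)
    case Nil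
    \<comment> \<open>The identity has to be produced as a product of generators, here aa.\<close>
    show ?case using mult[OF letter[of La] letter[of La]] by simp
  next
    case (Cons x u)
    then have "u \<in> ?G" using words_ConsD by blast
    from mult[OF letter[of x] this] show ?case using Cons.prems by (simp add: lmult_Cons)
  qed
  ultimately show ?thesis by (auto simp: nondegenerate_def Gamma_grp_def)
qed

text \<open>Intermediate value theorem for the difference of the two sides of
  \<open>balance\<close>; its strict signs at 0 and 1 keep the root inside the open
  interval.\<close>

lemma (in letter_walk) ex_ratio: "\<exists>r. letter_walk_ratio \<mu> r"
proof -
  define G where "G r = \<beta>' * (3 * r - 1 - r\<^sup>2) - \<beta> * (1 - r - r\<^sup>2) -
    (\<beta>' * (1 - r) + \<beta> * r) * (r * \<beta>' - (1 - r) * \<beta>)" for r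
  have "\<beta>' * \<beta> < 1 * \<beta>"
    using pmf_pos pmf_sum by (intro mult_strict_right_mono) auto
  moreover have "G 0 = \<beta>' * \<beta> - \<beta> - \<beta>'" "G 1 = \<beta> + \<beta>' - \<beta>' * \<beta>"
    by (simp_all add: G_def)
  ultimately have G: "G 0 < 0" "0 < G 1"
    using pmf_pos by linarith+
  have "continuous_on {0..1} G"
    unfolding G_def by (intro continuous_intros)
  with G obtain r where r: "0 \<le> r" "r \<le> 1" "G r = 0"
    using IVT'[of G 0 0 1] by auto
  moreover have "r \<noteq> 0" "r \<noteq> 1" using r(3) G by auto
  ultimately have "letter_walk_ratio \<mu> r"
    by unfold_locales (auto simp: G_def)
  then show ?thesis ..
qed

lemma ex_letter_pmf:
  fixes x y z :: real
  assumes "0 < x" "0 < y" "0 < z" "x + y + z = 1"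
  shows "\<exists>\<mu>. letter_walk \<mu> \<and> pmf \<mu> [La] = x \<and> pmf \<mu> [Lb] = y \<and> pmf \<mu> [Lbar] = z"
proof -
  define xs where "xs = [([La], x), ([Lb], y), ([Lbar], z)]"
  have wf: "pmf_of_list_wf xs"
    using assms by (intro pmf_of_list_wfI) (auto simp: xs_def)
  have "pmf (pmf_of_list xs) [La] = x" "pmf (pmf_of_list xs) [Lb] = y" "pmf (pmf_of_list xs) [Lbar] = z"
    unfolding pmf_pmf_of_list[OF wf] by (simp_all add: xs_def)
  moreover have "set_pmf (pmf_of_list xs) \<subseteq> {[La], [Lb], [Lbar]}"
    using set_pmf_of_list[OF wf] by (simp add: xs_def)
  ultimately show ?thesis using assms by (intro exI[of _ "pmf_of_list xs"]) (simp add: letter_walk_def)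
qed

lemma letter_walk_convex_comb:
  assumes "letter_walk \<mu>" "letter_walk \<mu>'" "0 < t" "t < 1"
  shows "letter_walk (convex_comb_pmf t \<mu> \<mu>')"
proof -
  interpret A: letter_walk \<mu> by fact
  interpret B: letter_walk \<mu>' by fact
  show ?thesis
  proof
    show "set_pmf (convex_comb_pmf t \<mu> \<mu>') \<subseteq> {[La], [Lb], [Lbar]}"
      using A.set_pmf_subset B.set_pmf_subset by (auto simp: convex_comb_pmf_def split: if_splits)
  qed (use A.pmf_pos B.pmf_pos assms in \<open>auto simp: pmf_convex_comb_pmf intro!: add_pos_pos\<close>)
qed

text \<open>The probabilities \<open>(\<beta>, \<beta>')\<close> for which the balance equation holds with \<open>r = 5/11\<close> form a conic
  through \<open>(1/20, 1/8)\<close> and \<open>(1/12, 7/18)\<close>, and the open chord between these points avoids it.\<close>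

theorem mainTheorem2:
  shows "\<exists>\<mu>1 \<mu>2 :: letter list pmf.
    set_pmf \<mu>1 \<subseteq> {[La], [Lb], [Lbar]} \<and> nondegenerate \<mu>1 \<and>
    set_pmf \<mu>2 \<subseteq> {[La], [Lb], [Lbar]} \<and> nondegenerate \<mu>2 \<and>
    equivalent_measures (harmonic_measure \<mu>1) (harmonic_measure \<mu>2) \<and>
    (\<forall>t::real. 0 < t \<and> t < 1 \<longrightarrow>
      singular_measures (harmonic_measure (convex_comb_pmf t \<mu>1 \<mu>2)) (harmonic_measure \<mu>1) \<and>
      singular_measures (harmonic_measure (convex_comb_pmf t \<mu>1 \<mu>2)) (harmonic_measure \<mu>2))"
proof -
  obtain \<mu>1 where 1: "letter_walk \<mu>1" "pmf \<mu>1 [Lb] = 1 / 20" "pmf \<mu>1 [Lbar] = 1 / 8"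
    using ex_letter_pmf[of "33 / 40" "1 / 20" "1 / 8"] by auto
  obtain \<mu>2 where 2: "letter_walk \<mu>2" "pmf \<mu>2 [Lb] = 1 / 12" "pmf \<mu>2 [Lbar] = 7 / 18"
    using ex_letter_pmf[of "19 / 36" "1 / 12" "7 / 18"] by auto
  interpret M1: letter_walk \<mu>1 by fact
  interpret M2: letter_walk \<mu>2 by fact
  have R1: "letter_walk_ratio \<mu>1 (5 / 11)"
    by unfold_locales (simp_all add: 1 power2_eq_square)
  have R2: "letter_walk_ratio \<mu>2 (5 / 11)"
    by unfold_locales (simp_all add: 2 power2_eq_square)
  have "equivalent_measures (harmonic_measure \<mu>1) (harmonic_measure \<mu>2)"
    using absolutely_continuous_harmonic_measure[OF R1 R2] absolutely_continuous_harmonic_measure[OF R2 R1]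
    by (simp add: equivalent_measures_def)
  moreover have "singular_measures (harmonic_measure (convex_comb_pmf t \<mu>1 \<mu>2)) (harmonic_measure \<mu>1) \<and>
      singular_measures (harmonic_measure (convex_comb_pmf t \<mu>1 \<mu>2)) (harmonic_measure \<mu>2)"
    if t: "0 < t" "t < 1" for t
  proof -
    interpret T: letter_walk "convex_comb_pmf t \<mu>1 \<mu>2"
      using letter_walk_convex_comb[OF 1(1) 2(1) t] .
    obtain r where R: "letter_walk_ratio (convex_comb_pmf t \<mu>1 \<mu>2) r"
      using T.ex_ratio by blast
    have "r \<noteq> 5 / 11"
    proof
      assume r: "r = 5 / 11"
      define y z where "y = t * (1 / 20) + (1 - t) * (1 / 12)" and "z = t * (1 / 8) + (1 - t) * (7 / 18)"
      have "z * (3 * r - 1 - r\<^sup>2) - y * (1 - r - r\<^sup>2) = (z * (1 - r) + y * r) * (r * z - (1 - r) * y)"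
        using letter_walk_ratio.balance[OF R] t by (simp add: pmf_convex_comb_pmf 1 2 y_def z_def)
      \<comment> \<open>Along the chord the defect in the balance equation is a quadratic polynomial
        in \<open>t\<close> vanishing at both ends, hence a multiple of t(1 - t); its coefficient is
        nonzero.\<close>
      moreover have "z * (3 * r - 1 - r\<^sup>2) - y * (1 - r - r\<^sup>2) -
          (z * (1 - r) + y * r) * (r * z - (1 - r) * y) = 2821 / 174240 * (t * (1 - t))"
        unfolding r y_def z_def by (simp add: field_simps power2_eq_square)
      ultimately show False using t by simp
    qed
    then show ?thesis
      using singular_harmonic_measure[OF R R1] singular_harmonic_measure[OF R R2] by blast
  qed
  ultimately show ?thesis
    using M1.set_pmf_subset M1.nondegenerate M2.set_pmf_subset M2.nondegenerate by blast
qed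

end
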